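(* Assume that $\varphi$ satisfies Conditions (C1), (C2), (C3), (C4) described in the context, and that $\Omega$ is bounded, connected and has a Lipschitz boundary. Then $\Lambda(\Omega)$ is a Banach space with the norm $|\cdot|_{p,\Omega}$. Each coset $\mathbf U\in\Lambda(\Omega)$ contains a unique representative $u$ which belongs to $L_{p_-}(\Omega)$ and has zero mean value $\langle u\rangle_\Omega:=\frac{1}{\operatorname{mes}\Omega}\int_\Omega u(x)\,dx=0$. In this sense $\mathcal L(\Omega)=\Lambda(\Omega)\oplus\mathbb C$: every $u\in\mathcal L(\Omega)$ is represented as $u=u_{\perp,\Omega}+\langle u\rangle_\Omega$ with $\langle u_{\perp,\Omega}\rangle_\Omega=0$, where $u_{\perp,\Omega}$ is an element of the coset in $\Lambda(\Omega)$ generated by $u$. Moreover, there are positive constants $c_3,c_4$, independent of $u$ but depending on $\Omega$, such that for all $u\in\mathcal L(\Omega)$ $$c_3\big(|u_{\perp,\Omega}|_{p,\Omega}+|\langle u\rangle_\Omega|\big)\le\|u\|_{\mathcal L(\Omega)}\le c_4\big(|u_{\perp,\Omega}|_{p,\Omega}+|\langle u\rangle_\Omega|\big).$$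
   Context: Let $d\ge 1$ and let $\Omega\subseteq\mathbb R^d$ be a domain. Functions are complex-valued. Let $a\in L_1(\mathbb R^d)$, $a\ge 0$, and suppose there is a non-empty ball $B_0$ centered at $0$ with $a(z)\ge c_0>0$ for a.e. $z\in B_0$. A real function $r$ on $[0,\infty)$ is almost increasing (resp. almost decreasing) with constant $\beta\ge1$ if $r(s)\le\beta r(t)$ (resp. $\beta r(s)\ge r(t)$) for all $0\le s\le t$. Let $\varphi:[0,\infty)\times\Omega\times\Omega\to[0,\infty)$. Conditions: (C1) for each $u\in L_{1,loc}(\Omega)$ the function $(x,y)\mapsto\varphi(|u(x)-u(y)|,x,y)$ is measurable on $\Omega\times\Omega$; (C2) for every $\varepsilon>0$ there is $\delta\in(0,1)$ such that $\varphi(\frac{s+t}{2},x,y)\le(1-\delta)\frac{\varphi(s,x,y)+\varphi(t,x,y)}{2}$ for a.e. $(x,y)$ and all $s,t>0$ with $|s-t|\ge\varepsilon\max\{s,t\}$; (C3) there are constants $1<p_-\le p_+$ and $\beta\ge1$ such that for a.e. $(x,y)$ the function $t\mapsto\varphi(t,x,y)/t^{p_-}$ is almost increasing with constant $\beta$ and $t\mapsto\varphi(t,x,y)/t^{p_+}$ is almost decreasing with constant $\beta$; (C4) for a.e. $(x,y)$: $c_1^{-1}\le\varphi(1,x,y)\le c_1$ with a constant $c_1>0$, $\varphi(0,x,y)=0$, and $\varphi(t,x,y)>0$ for $t>0$. Define for $u\in L_{1,loc}(\Omega)$: $F(u)=\int_{\Omega\times\Omega}\varphi(|u(x)-u(y)|,x,y)\,a(x-y)\,dx\,dy\in[0,+\infty]$,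 $|u|_{p,\Omega}=\inf\{\lambda>0: F(u/\lambda)\le1\}$, $f(u)=|u|_{p,\Omega}+\|u\|_{L_{p_-}(\Omega)}$, $\mathcal L(\Omega)=\{u\in L_{p_-,loc}(\Omega): f(u)<+\infty\}$ with norm $\|u\|_{\mathcal L(\Omega)}=f(u)$. On $L_{1,loc}(\Omega)$ let $u\sim v$ iff $u-v$ is a.e. constant; $\Lambda(\Omega)$ is the space of cosets $\mathbf U$ with $|u|_{p,\Omega}<\infty$ for $u\in\mathbf U$, normed by $|\mathbf U|_{p,\Omega}:=|u|_{p,\Omega}$, $u\in\mathbf U$. *)

theory Defs
  imports "HOL-Analysis.Analysis"
begin

definition almost_increasing_on :: "real set \<Rightarrow> real \<Rightarrow> (real \<Rightarrow> real) \<Rightarrow> bool" where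
  "almost_increasing_on S \<beta> r \<longleftrightarrow> \<beta> \<ge> 1 \<and> (\<forall>s\<in>S. \<forall>t\<in>S. s \<le> t \<longrightarrow> r s \<le> \<beta> * r t)"

definition almost_decreasing_on :: "real set \<Rightarrow> real \<Rightarrow> (real \<Rightarrow> real) \<Rightarrow> bool" where
  "almost_decreasing_on S \<beta> r \<longleftrightarrow> \<beta> \<ge> 1 \<and> (\<forall>s\<in>S. \<forall>t\<in>S. s \<le> t \<longrightarrow> \<beta> * r s \<ge> r t)"

text \<open>Lipschitz boundary: locally, Omega is the subgraph of a Lipschitz function
  over a hyperplane (in rotated coordinates given by the unit vector e).\<close>
definition lipschitz_boundary :: "'a::euclidean_space set \<Rightarrow> bool" where
  "lipschitz_boundary \<Omega> \<longleftrightarrow>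
     (\<forall>x\<in>frontier \<Omega>. \<exists>r>0. \<exists>e. norm e = 1 \<and> (\<exists>g C. C-lipschitz_on {z. z \<bullet> e = 0} g \<and>
        \<Omega> \<inter> ball x r = {y \<in> ball x r. y \<bullet> e < g (y - (y \<bullet> e) *\<^sub>R e)}))"

definition L1loc :: "'a::euclidean_space set \<Rightarrow> ('a \<Rightarrow> complex) \<Rightarrow> bool" where
  "L1loc \<Omega> u \<longleftrightarrow> (\<forall>K. compact K \<and> K \<subseteq> \<Omega> \<longrightarrow> set_integrable lebesgue K u)"

definition Lploc :: "'a::euclidean_space set \<Rightarrow> real \<Rightarrow> ('a \<Rightarrow> complex) \<Rightarrow> bool" where
  "Lploc \<Omega> p u \<longleftrightarrow> (\<forall>K. compact K \<and> K \<subseteq> \<Omega> \<longrightarrow>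
      set_borel_measurable lebesgue K u \<and> set_integrable lebesgue K (\<lambda>x. norm (u x) powr p))"

definition Lp_on :: "'a::euclidean_space set \<Rightarrow> real \<Rightarrow> ('a \<Rightarrow> complex) \<Rightarrow> bool" where
  "Lp_on \<Omega> p u \<longleftrightarrow> set_borel_measurable lebesgue \<Omega> u \<and>
      set_integrable lebesgue \<Omega> (\<lambda>x. norm (u x) powr p)"

definition Lp_norm :: "'a::euclidean_space set \<Rightarrow> real \<Rightarrow> ('a \<Rightarrow> complex) \<Rightarrow> ennreal" where
  "Lp_norm \<Omega> p u = (if Lp_on \<Omega> p u
      then ennreal ((LINT x:\<Omega>|lebesgue. norm (u x) powr p) powr (1 / p)) else top)"

definition Fint :: "(real \<Rightarrow> 'a \<Rightarrow> 'a \<Rightarrow> real) \<Rightarrow> ('a::euclidean_space \<Rightarrow> real) \<Rightarrow> 'a set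
                     \<Rightarrow> ('a \<Rightarrow> complex) \<Rightarrow> ennreal" where
  "Fint \<phi> a \<Omega> u = (\<integral>\<^sup>+ z. indicator (\<Omega> \<times> \<Omega>) z *
       ennreal (\<phi> (cmod (u (fst z) - u (snd z))) (fst z) (snd z) * a (fst z - snd z)) \<partial>lebesgue)"

text \<open>|u|_{p,Omega} = inf {lambda > 0. F(u/lambda) <= 1} (infinite if the set is empty).\<close>
definition lux :: "(real \<Rightarrow> 'a \<Rightarrow> 'a \<Rightarrow> real) \<Rightarrow> ('a::euclidean_space \<Rightarrow> real) \<Rightarrow> 'a set
                     \<Rightarrow> ('a \<Rightarrow> complex) \<Rightarrow> ennreal" where
  "lux \<phi> a \<Omega> u = Inf {ennreal lam | lam. lam > 0 \<and> Fint \<phi> a \<Omega> (\<lambda>x. u x / complex_of_real lam) \<le> 1}"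

definition fnorm :: "(real \<Rightarrow> 'a \<Rightarrow> 'a \<Rightarrow> real) \<Rightarrow> ('a::euclidean_space \<Rightarrow> real) \<Rightarrow> 'a set
                     \<Rightarrow> real \<Rightarrow> ('a \<Rightarrow> complex) \<Rightarrow> ennreal" where
  "fnorm \<phi> a \<Omega> pm u = lux \<phi> a \<Omega> u + Lp_norm \<Omega> pm u"

definition Lcal :: "(real \<Rightarrow> 'a \<Rightarrow> 'a \<Rightarrow> real) \<Rightarrow> ('a::euclidean_space \<Rightarrow> real) \<Rightarrow> 'a set
                     \<Rightarrow> real \<Rightarrow> ('a \<Rightarrow> complex) \<Rightarrow> bool" where
  "Lcal \<phi> a \<Omega> pm u \<longleftrightarrow> Lploc \<Omega> pm u \<and> fnorm \<phi> a \<Omega> pm u < top"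

definition coset_eq :: "'a::euclidean_space set \<Rightarrow> ('a \<Rightarrow> complex) \<Rightarrow> ('a \<Rightarrow> complex) \<Rightarrow> bool" where
  "coset_eq \<Omega> u v \<longleftrightarrow> (\<exists>c. AE x in lebesgue. x \<in> \<Omega> \<longrightarrow> u x - v x = c)"

definition Lambda_rep :: "(real \<Rightarrow> 'a \<Rightarrow> 'a \<Rightarrow> real) \<Rightarrow> ('a::euclidean_space \<Rightarrow> real) \<Rightarrow> 'a set
                     \<Rightarrow> ('a \<Rightarrow> complex) \<Rightarrow> bool" where
  "Lambda_rep \<phi> a \<Omega> u \<longleftrightarrow> L1loc \<Omega> u \<and> lux \<phi> a \<Omega> u < top"

definition mean_val :: "'a::euclidean_space set \<Rightarrow> ('a \<Rightarrow> complex) \<Rightarrow> complex" where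
  "mean_val \<Omega> u = (LINT x:\<Omega>|lebesgue. u x) / complex_of_real (measure lebesgue \<Omega>)"

definition perp_part :: "'a::euclidean_space set \<Rightarrow> ('a \<Rightarrow> complex) \<Rightarrow> ('a \<Rightarrow> complex)" where
  "perp_part \<Omega> u = (\<lambda>x. u x - mean_val \<Omega> u)"

definition kernel_cond :: "('a::euclidean_space \<Rightarrow> real) \<Rightarrow> bool" where
  "kernel_cond a \<longleftrightarrow> integrable lebesgue a \<and> (\<forall>z. a z \<ge> 0) \<and>
     (\<exists>r>0. \<exists>c0>0. AE z in lebesgue. z \<in> ball 0 r \<longrightarrow> a z \<ge> c0)"

definition C1 :: "(real \<Rightarrow> 'a \<Rightarrow> 'a \<Rightarrow> real) \<Rightarrow> 'a::euclidean_space set \<Rightarrow> bool" where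
  "C1 \<phi> \<Omega> \<longleftrightarrow> (\<forall>u. L1loc \<Omega> u \<longrightarrow>
     (\<lambda>z. \<phi> (cmod (u (fst z) - u (snd z))) (fst z) (snd z))
        \<in> borel_measurable (restrict_space lebesgue (\<Omega> \<times> \<Omega>)))"

definition C2 :: "(real \<Rightarrow> 'a \<Rightarrow> 'a \<Rightarrow> real) \<Rightarrow> 'a::euclidean_space set \<Rightarrow> bool" where
  "C2 \<phi> \<Omega> \<longleftrightarrow> (\<forall>\<epsilon>>0. \<exists>\<delta>. 0 < \<delta> \<and> \<delta> < 1 \<and>
     (AE z in lebesgue. z \<in> \<Omega> \<times> \<Omega> \<longrightarrow>
        (\<forall>s t. s > 0 \<and> t > 0 \<and> \<bar>s - t\<bar> \<ge> \<epsilon> * max s t \<longrightarrow>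
           \<phi> ((s + t) / 2) (fst z) (snd z)
             \<le> (1 - \<delta>) * ((\<phi> s (fst z) (snd z) + \<phi> t (fst z) (snd z)) / 2))))"

definition C3 :: "(real \<Rightarrow> 'a \<Rightarrow> 'a \<Rightarrow> real) \<Rightarrow> 'a::euclidean_space set \<Rightarrow> real \<Rightarrow> real \<Rightarrow> bool" where
  "C3 \<phi> \<Omega> pm pp \<longleftrightarrow> 1 < pm \<and> pm \<le> pp \<and> (\<exists>\<beta>\<ge>1.
     AE z in lebesgue. z \<in> \<Omega> \<times> \<Omega> \<longrightarrow>
       almost_increasing_on {0<..} \<beta> (\<lambda>t. \<phi> t (fst z) (snd z) / t powr pm) \<and>
       almost_decreasing_on {0<..} \<beta> (\<lambda>t. \<phi> t (fst z) (snd z) / t powr pp))"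

definition C4 :: "(real \<Rightarrow> 'a \<Rightarrow> 'a \<Rightarrow> real) \<Rightarrow> 'a::euclidean_space set \<Rightarrow> bool" where
  "C4 \<phi> \<Omega> \<longleftrightarrow> (\<exists>c1>0. AE z in lebesgue. z \<in> \<Omega> \<times> \<Omega> \<longrightarrow>
       inverse c1 \<le> \<phi> 1 (fst z) (snd z) \<and> \<phi> 1 (fst z) (snd z) \<le> c1 \<and>
       \<phi> 0 (fst z) (snd z) = 0 \<and> (\<forall>t>0. \<phi> t (fst z) (snd z) > 0))"

end

theory Submission
  imports Defs
begin

text \<open>
  By (C2) with \<open>\<epsilon> = 1/n\<close>, almost every \<open>\<phi>(\<cdot>, x, y)\<close> is midpoint convex, and (C3) bounds it locally, so it
  is convex, continuous and nondecreasing on \<open>[0, \<infinity>)\<close>; this makes the Luxemburg functional a seminorm,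
  lower semicontinuous under a.e. convergence (Fatou). (C3) and (C4) give \<open>t^p \<le> 1 + k \<phi>(t, x, y)\<close> with
  \<open>p = p_-\<close>, so \<open>F(u) \<le> 1\<close> bounds the integral of \<open>|u(x) - u(y)|^p\<close> over the pairs at distance less
  than \<open>r\<close>, where \<open>a \<ge> c_0\<close>.

  The key step is a nonlocal Poincare inequality: that integral controls the one over all of
  \<open>\<Omega> \<times> \<Omega>\<close>. Cover \<open>\<Omega>\<close> by finitely many sets \<open>\<Omega> \<inter> ball x (r/4)\<close>; by connectedness any two of them
  are joined by a chain of such sets with close neighbours, and the quasi-triangle inequality for
  \<open>|u(x) - u(y)|^p\<close>, averaged over the intermediate point, propagates the bound along the chain.
  Applied to \<open>u/l\<close> with \<open>l\<close> above the Luxemburg norm, it bounds \<open>u\<close> minus its mean in \<open>L_p\<close>. For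
  completeness, the mean-free parts of a Cauchy sequence are Cauchy in \<open>L_1\<close>, and the limit of an a.e.
  convergent subsequence is the limit in the seminorm by lower semicontinuity.
\<close>

section \<open>Midpoint convex functions on the half-line\<close>

text \<open>A Bernstein-Doetsch argument: an upper bound on each segment is the only regularity
  required, and continuity is a consequence. Subtracting the chord reduces the claim to a function
  on \<open>[0, 1]\<close> that vanishes at both ends.\<close>

lemma midpoint_convex_imp_convex_on:
  fixes f :: "real \<Rightarrow> real"
  assumes S: "convex S"
    and mid: "\<And>x y. x \<in> S \<Longrightarrow> y \<in> S \<Longrightarrow> f ((x + y) / 2) \<le> (f x + f y) / 2"
    and bdd: "\<And>x y. x \<in> S \<Longrightarrow> y \<in> S \<Longrightarrow> bdd_above (f ` {x..y})"
  shows "convex_on S f"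
proof (rule convex_on_linorderI[OF _ S])
  fix t x y :: real
  assume t: "0 < t" "t < 1" and x: "x \<in> S" and y: "y \<in> S" and "x < y"
  define g where "g s = f ((1 - s) * x + s * y) - ((1 - s) * f x + s * f y)" for s
  have inS: "(1 - s) * x + s * y \<in> S" if "s \<in> {0..1}" for s
    using convexD_alt[OF S x y, of s] that by simp
  have half: "g ((s + s') / 2) \<le> (g s + g s') / 2" if "s \<in> {0..1}" "s' \<in> {0..1}" for s s'
  proof -
    have "(1 - (s + s') / 2) * x + (s + s') / 2 * y
          = (((1 - s) * x + s * y) + ((1 - s') * x + s' * y)) / 2"
      by (simp add: field_simps)
    moreover have "(1 - (s + s') / 2) * f x + (s + s') / 2 * f y
          = (((1 - s) * f x + s * f y) + ((1 - s') * f x + s' * f y)) / 2"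
      by (simp add: field_simps)
    ultimately show ?thesis
      using mid[OF inS[OF that(1)] inS[OF that(2)]] unfolding g_def by argo
  qed
  have g01: "g 0 = 0" "g 1 = 0"
    by (auto simp: g_def)
  have bg: "bdd_above (g ` {0..1})"
  proof -
    obtain B where B: "\<And>z. z \<in> {x..y} \<Longrightarrow> f z \<le> B"
      using bdd[OF x y] unfolding bdd_above_def by blast
    have "g s \<le> B + \<bar>f x\<bar> + \<bar>f y\<bar>" if s: "s \<in> {0..1}" for s
    proof -
      have "(1 - s) * x + s * y \<in> {x..y}"
        using convexD_alt[of "{x..y}" x y s] s \<open>x < y\<close> by simp
      then have "f ((1 - s) * x + s * y) \<le> B"
        by (rule B)
      moreover have "\<bar>(1 - s) * f x\<bar> \<le> \<bar>f x\<bar>" "\<bar>s * f y\<bar> \<le> \<bar>f y\<bar>"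
        using s by (auto simp: abs_mult intro!: mult_left_le_one_le)
      ultimately show ?thesis
        unfolding g_def by linarith
    qed
    then show ?thesis unfolding bdd_above_def by blast
  qed
  define M where "M = Sup (g ` {0..1})"
  have le_M: "g s \<le> M" if "s \<in> {0..1}" for s
    unfolding M_def using that bg by (intro cSup_upper) auto
  have "g s \<le> M / 2" if s: "s \<in> {0..1}" for s
  proof (cases "s \<le> 1 / 2")
    case True
    then show ?thesis using half[of 0 "2 * s"] le_M[of "2 * s"] g01 s by simp
  next
    case False
    then show ?thesis using half[of 1 "2 * s - 1"] le_M[of "2 * s - 1"] g01 s by simp
  qed
  \<comment> \<open>The excess \<open>g\<close> over the chord has \<open>sup g \<le> (sup g) / 2\<close>, because every point is the midpoint of
    an endpoint and a further point of the segment.\<close>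
  then have "M \<le> M / 2"
    unfolding M_def by (intro cSup_least) auto
  then have "g t \<le> 0"
    using le_M[of t] t by simp
  then show "f ((1 - t) *\<^sub>R x + t *\<^sub>R y) \<le> (1 - t) * f x + t * f y"
    by (simp add: g_def)
qed

text \<open>Almost monotonicity of \<open>f t / t powr p\<close> plays two roles. It bounds
  \<open>f\<close> above on segments of \<open>(0, \<infinity>)\<close>, as the midpoint argument
  demands, and it gives \<open>f t \<le> \<beta> * f 1 * t powr p\<close> near \<open>0\<close>,
  hence continuity there.\<close>

lemma almost_increasing_imp_convex:
  fixes f :: "real \<Rightarrow> real"
  assumes f0: "f 0 = 0" and nonneg: "\<And>t. t \<ge> 0 \<Longrightarrow> f t \<ge> 0"
    and mid: "\<And>s t. s > 0 \<Longrightarrow> t > 0 \<Longrightarrow> f ((s + t) / 2) \<le> (f s + f t) / 2"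
    and p: "p > 0" and incr: "almost_increasing_on {0<..} \<beta> (\<lambda>t. f t / t powr p)"
  shows "convex_on {0..} f" and "continuous_on {0..} f"
proof -
  have b: "f s \<le> \<beta> * f t / t powr p * s powr p" if "0 < s" "s \<le> t" for s t
    using incr that by (auto simp: almost_increasing_on_def field_simps)
  have beta: "\<beta> \<ge> 1"
    using incr by (simp add: almost_increasing_on_def)
  have pos: "convex_on {0<..} f"
  proof (rule midpoint_convex_imp_convex_on)
    fix x y :: real assume "x \<in> {0<..}" "y \<in> {0<..}"
    \<comment> \<open>Comparison with the right endpoint bounds \<open>f\<close> on the whole
      segment.\<close>
    then have "f z \<le> \<beta> * f y / y powr p * y powr p" if "z \<in> {x..y}" for z
      using that p beta nonneg[of y]
      by (intro order_trans[OF b[of z y]] mult_left_mono powr_mono2) auto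
    then show "bdd_above (f ` {x..y})"
      unfolding bdd_above_def by blast
  qed (use mid in auto)
  have cont: "continuous_on {0<..} f"
    by (intro convex_on_continuous pos) auto
  have lim0: "(f \<longlongrightarrow> 0) (at 0 within {0..})"
  proof (rule tendsto_sandwich[of "\<lambda>_. 0"])
    have "\<forall>\<^sub>F t in at 0 within {0..}. t \<in> {0<..<1::real}"
      by (auto simp: eventually_at intro!: exI[of _ 1])
    then show "\<forall>\<^sub>F t in at 0 within {0..}. f t \<le> \<beta> * f 1 * t powr p"
      by eventually_elim (use b[of _ 1] in auto)
    have ge0: "\<forall>\<^sub>F t in at 0 within {0..}. (0::real) \<le> t"
      by (simp add: eventually_at_filter)
    from ge0 show "\<forall>\<^sub>F t in at 0 within {0..}. 0 \<le> f t"
      by eventually_elim (rule nonneg)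
    have "((\<lambda>t::real. t powr p) \<longlongrightarrow> 0 powr p) (at 0 within {0..})"
      using p ge0 by (intro tendsto_powr'[OF tendsto_ident_at tendsto_const]) simp
    then have "((\<lambda>t::real. t powr p) \<longlongrightarrow> 0) (at 0 within {0..})"
      by simp
    then show "((\<lambda>t. \<beta> * f 1 * t powr p) \<longlongrightarrow> 0) (at 0 within {0..})"
      by (rule tendsto_mult_right_zero)
  qed auto
  show C: "continuous_on {0..} f"
    unfolding continuous_on_eq_continuous_within
  proof
    fix x :: real assume "x \<in> {0..}"
    show "continuous (at x within {0..}) f"
    proof (cases "x = 0")
      case True
      then show ?thesis using lim0 f0 by (simp add: continuous_within)
    next
      case False
      then have "continuous (at x) f"
        using cont \<open>x \<in> {0..}\<close> by (auto simp: continuous_on_eq_continuous_at)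
      then show ?thesis by (rule continuous_at_imp_continuous_within)
    qed
  qed
  \<comment> \<open>The midpoint inequality is available only for positive arguments, so the
    endpoint \<open>0\<close> is replaced by \<open>s > 0\<close> and \<open>s\<close> then tends to
    \<open>0\<close>.\<close>
  have zero: "f (u * y) \<le> u * f y" if u: "0 < u" "u < 1" and y: "0 < y" for u y
  proof (rule tendsto_le[of "at_right (0::real)"])
    have "((\<lambda>s. (1 - u) * s + u * y) \<longlongrightarrow> (1 - u) * 0 + u * y) (at_right 0)"
      by (intro tendsto_intros)
    then have "((\<lambda>s. (1 - u) * s + u * y) \<longlongrightarrow> u * y) (at_right 0)"
      by simp
    moreover have "isCont f (u * y)"
      using cont u y by (auto simp: continuous_on_eq_continuous_at)
    ultimately show "((\<lambda>s. f ((1 - u) * s + u * y)) \<longlongrightarrow> f (u * y)) (at_right 0)"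
      by (rule isCont_tendsto_compose[rotated])
    have "(f \<longlongrightarrow> 0) (at_right 0)"
      by (rule tendsto_within_subset[OF lim0]) auto
    then have "((\<lambda>s. (1 - u) * f s + u * f y) \<longlongrightarrow> (1 - u) * 0 + u * f y) (at_right 0)"
      by (intro tendsto_intros)
    then show "((\<lambda>s. (1 - u) * f s + u * f y) \<longlongrightarrow> u * f y) (at_right 0)"
      by simp
    have "\<forall>\<^sub>F s in at_right 0. s > (0::real)"
      by (simp add: eventually_at_filter)
    then show "\<forall>\<^sub>F s in at_right 0. f ((1 - u) * s + u * y) \<le> (1 - u) * f s + u * f y"
      by eventually_elim (use convex_onD[OF pos, of u _ y] u y in auto)
  qed auto
  show "convex_on {0..} f"
  proof (rule convex_on_linorderI)
    fix t x y :: real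
    assume "0 < t" "t < 1" "x \<in> {0..}" "y \<in> {0..}" "x < y"
    then show "f ((1 - t) *\<^sub>R x + t *\<^sub>R y) \<le> (1 - t) * f x + t * f y"
      using zero[of t y] f0 convex_onD[OF pos, of t x y] by (cases "x = 0") auto
  qed (rule convex_real_interval)
qed

text \<open>With \<open>f 0 = 0\<close>, the point \<open>s\<close> is the convex combination of
  \<open>0\<close> and \<open>t\<close> with weight \<open>s / t\<close>, so
  \<open>f s \<le> s / t * f t\<close>.\<close>

lemma convex_on_nonneg_mono:
  fixes f :: "real \<Rightarrow> real"
  assumes cvx: "convex_on {0..} f" and f0: "f 0 = 0" and nonneg: "\<And>t. t \<ge> 0 \<Longrightarrow> f t \<ge> 0"
    and st: "0 \<le> s" "s \<le> t"
  shows "f s \<le> f t"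
proof (cases "t = 0")
  case False
  then have "f s \<le> s / t * f t"
    using convex_onD[OF cvx, of "s / t" 0 t] st f0 by (auto simp: field_simps)
  also have "\<dots> \<le> 1 * f t"
    using st False nonneg[of t] by (intro mult_right_mono) auto
  finally show ?thesis by simp
qed (use st in auto)

text \<open>For \<open>t \<le> 1\<close> the summand \<open>1\<close> suffices; for larger
  \<open>t\<close>, comparing the quotient at \<open>1\<close> and at \<open>t\<close> gives
  \<open>inverse c \<le> f 1 \<le> \<beta> * (f t / t powr p)\<close>.\<close>

lemma almost_increasing_imp_coercive:
  fixes f :: "real \<Rightarrow> real"
  assumes nonneg: "\<And>t. t \<ge> 0 \<Longrightarrow> f t \<ge> 0" and p: "p \<ge> 0" and c: "c > 0" "inverse c \<le> f 1"
    and incr: "almost_increasing_on {0<..} \<beta> (\<lambda>t. f t / t powr p)" and t: "t \<ge> 0"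
  shows "t powr p \<le> 1 + \<beta> * c * f t"
proof (cases "t \<le> 1")
  case True
  then have "t powr p \<le> 1"
    using p t powr_mono2[of p t 1] by simp
  moreover have "0 \<le> \<beta> * c * f t"
    using incr c nonneg[OF t] by (simp add: almost_increasing_on_def)
  ultimately show ?thesis by simp
next
  case False
  then have "f 1 / 1 powr p \<le> \<beta> * (f t / t powr p)"
    using incr[unfolded almost_increasing_on_def, THEN conjunct2, rule_format, of 1 t] by simp
  then have "inverse c \<le> \<beta> * (f t / t powr p)"
    using c by simp
  then have "t powr p * c * inverse c \<le> t powr p * c * (\<beta> * (f t / t powr p))"
    using c by (intro mult_left_mono) auto
  moreover have "t powr p * c * inverse c = t powr p"
    using c by simp
  moreover have "t powr p * c * (\<beta> * (f t / t powr p)) = \<beta> * c * f t"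
    using False by simp
  ultimately show ?thesis by linarith
qed

section \<open>Null sets and measurability on the product\<close>

text \<open>The exceptional set is enlarged to a Borel null set, so that its preimages under Borel
  maps remain measurable.\<close>

lemma AE_lebesgue_null_lborel:
  assumes "AE x in lebesgue. P (x :: 'a::euclidean_space)"
  obtains N where "N \<in> null_sets lborel" "\<And>x. x \<notin> N \<Longrightarrow> P x"
proof -
  have "AE x in lborel. P x" using assms by (simp add: AE_completion_iff)
  then obtain N where "N \<in> null_sets lborel" "{x \<in> space lborel. \<not> P x} \<subseteq> N"
    by (auto simp: eventually_ae_filter)
  then show ?thesis using that by auto
qed

text \<open>Pulls an a.e. statement back along \<open>g\<close>. It is used for the two projections
  and for the difference map, which transport a.e. statements about points to a.e. statements about
  pairs.\<close>

lemma AE_lborel_subst: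
  fixes g :: "'a::euclidean_space \<times> 'b::euclidean_space \<Rightarrow> 'c::euclidean_space"
  assumes P: "AE x in lebesgue. P x"
    and [measurable]: "g \<in> borel_measurable (lborel \<Otimes>\<^sub>M lborel)"
    and null: "\<And>N. N \<in> null_sets lborel \<Longrightarrow> emeasure (lborel \<Otimes>\<^sub>M lborel) (g -` N) = 0"
  shows "AE z in lebesgue. P (g z)"
proof -
  obtain N where N: "N \<in> null_sets lborel" "\<And>x. x \<notin> N \<Longrightarrow> P x"
    using AE_lebesgue_null_lborel[OF P] by blast
  have "g -` N \<inter> space (lborel \<Otimes>\<^sub>M lborel) \<in> sets (lborel \<Otimes>\<^sub>M lborel)"
    using N(1) by (intro measurable_sets[of _ _ borel]) auto
  then have "g -` N \<in> null_sets (lborel \<Otimes>\<^sub>M lborel)"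
    using null[OF N(1)] by (auto simp: null_sets_def space_pair_measure)
  then have "AE z in lborel \<Otimes>\<^sub>M lborel. P (g z)"
    by (rule AE_I') (use N in auto)
  then show ?thesis
    unfolding lborel_prod by (rule AE_completion)
qed

lemma AE_lebesgue_fst:
  assumes "AE x in lebesgue. P (x :: 'a::euclidean_space)"
  shows "AE z in lebesgue. P (fst (z :: 'a \<times> 'b::euclidean_space))"
proof (rule AE_lborel_subst[OF assms])
  fix N :: "'a set" assume N: "N \<in> null_sets lborel"
  have "fst -` N = N \<times> (UNIV :: 'b set)" by auto
  then show "emeasure (lborel \<Otimes>\<^sub>M lborel) ((fst :: 'a \<times> 'b \<Rightarrow> 'a) -` N) = 0"
    using N by (auto simp: lborel.emeasure_pair_measure_Times null_sets_def)
qed simp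

lemma AE_lebesgue_snd:
  assumes "AE x in lebesgue. P (x :: 'b::euclidean_space)"
  shows "AE z in lebesgue. P (snd (z :: 'a::euclidean_space \<times> 'b))"
proof (rule AE_lborel_subst[OF assms])
  fix N :: "'b set" assume N: "N \<in> null_sets lborel"
  have "snd -` N = (UNIV :: 'a set) \<times> N" by auto
  then show "emeasure (lborel \<Otimes>\<^sub>M lborel) ((snd :: 'a \<times> 'b \<Rightarrow> 'b) -` N) = 0"
    using N by (auto simp: lborel.emeasure_pair_measure_Times null_sets_def)
qed simp

text \<open>By Tonelli it suffices to look at the sections of the preimage for fixed
  \<open>y\<close>; each is a translate of the null set \<open>N\<close>.\<close>

lemma AE_lebesgue_diff:
  assumes "AE x in lebesgue. P (x :: 'a::euclidean_space)"
  shows "AE z in lebesgue. P (fst (z :: 'a \<times> 'a) - snd z)"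
proof (rule AE_lborel_subst[OF assms])
  fix N :: "'a set" assume N: "N \<in> null_sets lborel"
  then have [measurable]: "N \<in> sets borel" by auto
  let ?S = "(\<lambda>z::'a \<times> 'a. fst z - snd z) -` N"
  have "?S \<in> sets (lborel \<Otimes>\<^sub>M lborel)"
    using measurable_sets[of "\<lambda>z::'a \<times> 'a. fst z - snd z" "lborel \<Otimes>\<^sub>M lborel" borel N]
    by (simp add: space_pair_measure)
  then have "emeasure (lborel \<Otimes>\<^sub>M lborel) ?S = (\<integral>\<^sup>+ z. indicator ?S z \<partial>(lborel \<Otimes>\<^sub>M lborel))"
    by (rule nn_integral_indicator[symmetric])
  also have "\<dots> = (\<integral>\<^sup>+ z. indicator N (fst z - snd z) \<partial>(lborel \<Otimes>\<^sub>M lborel))"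
    by (intro nn_integral_cong) (simp split: split_indicator)
  also have "\<dots> = (\<integral>\<^sup>+ y. \<integral>\<^sup>+ x. indicator N (x - y) \<partial>lborel \<partial>lborel)"
    by (subst lborel_pair.nn_integral_snd[symmetric]) auto
  also have "\<dots> = (\<integral>\<^sup>+ y. 0 \<partial>(lborel :: 'a measure))"
  proof (rule nn_integral_cong)
    fix y :: 'a
    have "(\<integral>\<^sup>+ x. indicator N (x - y) \<partial>lborel) = (\<integral>\<^sup>+ x. indicator N x \<partial>distr lborel borel ((+) (- y)))"
      by (subst nn_integral_distr) (auto simp: add.commute)
    also have "\<dots> = 0"
      using N by (simp add: lborel_distr_plus null_setsD1)
    finally show "(\<integral>\<^sup>+ x. indicator N (x - y) \<partial>lborel) = 0" .
  qed
  finally show "emeasure (lborel \<Otimes>\<^sub>M lborel) ((\<lambda>z::'a \<times> 'a. fst z - snd z) -` N) = 0" by simp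
qed simp

text \<open>A Lebesgue measurable function composed with a Borel map need not be Lebesgue
  measurable. Here a Borel version of \<open>a\<close> is composed instead, and the two compositions
  differ only on a null set because the difference map pulls null sets back to null sets.\<close>

lemma borel_measurable_lebesgue_diff:
  fixes a :: "'a::euclidean_space \<Rightarrow> real"
  assumes "a \<in> borel_measurable lebesgue"
  shows "(\<lambda>z. a (fst z - snd z)) \<in> borel_measurable lebesgue"
proof -
  obtain a' where [measurable]: "a' \<in> borel_measurable lborel" and ae: "AE x in lborel. a x = a' x"
    using completion_ex_borel_measurable_real[OF assms] by blast
  have "AE x in lebesgue. a' x = a x" using ae by (simp add: AE_completion_iff eq_commute)
  from AE_lebesgue_diff[OF this]
  have "AE z in lebesgue. a' (fst z - snd z) = a (fst z - snd z)" .
  moreover have "(\<lambda>z. a' (fst z - snd z)) \<in> borel_measurable lebesgue"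
    by (intro measurable_completion) (simp add: lborel_prod[symmetric])
  ultimately show ?thesis
    by (rule borel_measurable_AE[rotated])
qed

lemma lebesgue_complex_ex_borel:
  fixes f :: "'a::euclidean_space \<Rightarrow> complex"
  assumes f: "f \<in> borel_measurable lebesgue"
  obtains g where "g \<in> borel_measurable borel" "AE x in lebesgue. f x = g x"
proof -
  have "(\<lambda>x. Re (f x)) \<in> borel_measurable lebesgue" "(\<lambda>x. Im (f x)) \<in> borel_measurable lebesgue"
    using f by auto
  then obtain g h where g: "g \<in> borel_measurable lborel" "AE x in lborel. Re (f x) = g x"
    and h: "h \<in> borel_measurable lborel" "AE x in lborel. Im (f x) = h x"
    using completion_ex_borel_measurable_real by metis
  have "AE x in lborel. f x = Complex (g x) (h x)"
    using g(2) h(2) by eventually_elim (simp add: complex_eq_iff)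
  moreover have "(\<lambda>x. Complex (g x) (h x)) \<in> borel_measurable borel"
    using g(1) h(1) by (auto simp: borel_measurable_complex_iff)
  ultimately show ?thesis using that by (simp add: AE_completion_iff)
qed

text \<open>Local integrability gives measurability on compact subsets only; an exhaustion of
  \<open>\<Omega>\<close> by compact sets extends it by pointwise limits.\<close>

lemma L1loc_set_borel_measurable:
  fixes u :: "'a::euclidean_space \<Rightarrow> complex"
  assumes "open \<Omega>" "L1loc \<Omega> u"
  shows "set_borel_measurable lebesgue \<Omega> u"
proof (rule open_Union_compact_subsets[OF \<open>open \<Omega>\<close>])
  fix D :: "nat \<Rightarrow> 'a set"
  assume D: "\<And>n. compact (D n)" "\<And>n. D n \<subseteq> \<Omega>" "\<And>n. D n \<subseteq> interior (D (Suc n))" "(\<Union>n. D n) = \<Omega>"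
  have "incseq D"
    using D(3) interior_subset by (intro incseq_SucI) blast
  show "set_borel_measurable lebesgue \<Omega> u"
    unfolding set_borel_measurable_def
  proof (rule borel_measurable_LIMSEQ_metric)
    show "(\<lambda>x. indicator (D n) x *\<^sub>R u x) \<in> borel_measurable lebesgue" for n
      using assms(2) D(1,2)[of n] by (auto simp: L1loc_def set_integrable_def dest!: spec[of _ "D n"])
    show "(\<lambda>n. indicator (D n) x *\<^sub>R u x) \<longlonglongrightarrow> indicator \<Omega> x *\<^sub>R u x" for x
    proof (intro tendsto_intros)
      show "(\<lambda>n. indicator (D n) x :: real) \<longlonglongrightarrow> indicator \<Omega> x"
        using LIMSEQ_indicator_incseq[OF \<open>incseq D\<close>] D(4) by simp
    qed
  qed
qed

section \<open>A nonlocal Poincare inequality\<close>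

text \<open>Models \<open>|u(x) - u(y)|^p\<close> abstractly. Since the chaining argument sees only
  the constant \<open>c\<close>, its result is uniform over all such kernels, and hence over all
  functions \<open>u\<close>.\<close>

definition quasi_metric_kernel :: "real \<Rightarrow> ('a::euclidean_space \<times> 'a \<Rightarrow> ennreal) \<Rightarrow> bool" where
  "quasi_metric_kernel c K \<longleftrightarrow> K \<in> borel_measurable (borel \<Otimes>\<^sub>M borel) \<and>
     (\<forall>x y. K (x, y) = K (y, x)) \<and> (\<forall>x y z. K (x, y) \<le> ennreal c * (K (x, z) + K (z, y)))"

definition dint :: "('a::euclidean_space \<times> 'a \<Rightarrow> ennreal) \<Rightarrow> 'a set \<Rightarrow> 'a set \<Rightarrow> ennreal" where
  "dint K A B = (\<integral>\<^sup>+ x. \<integral>\<^sup>+ y. indicator A x * (indicator B y * K (x, y)) \<partial>lborel \<partial>lborel)"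

text \<open>The short-range part of the interaction; for pairs this close the weight
  \<open>a\<close> is bounded below almost everywhere.\<close>

definition dint_near :: "real \<Rightarrow> ('a::euclidean_space \<times> 'a \<Rightarrow> ennreal) \<Rightarrow> 'a set \<Rightarrow> ennreal" where
  "dint_near r K A =
     (\<integral>\<^sup>+ x. \<integral>\<^sup>+ y. indicator A x * (indicator (A \<inter> ball x r) y * K (x, y)) \<partial>lborel \<partial>lborel)"

lemma quasi_metric_kernel_measurable:
  "quasi_metric_kernel c K \<Longrightarrow> K \<in> borel_measurable (borel \<Otimes>\<^sub>M borel)"
  by (simp add: quasi_metric_kernel_def)

lemma dint_sym:
  assumes K: "quasi_metric_kernel c K" and [measurable]: "A \<in> sets borel" "B \<in> sets borel"
  shows "dint K A B = dint K B A"
proof -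
  note [measurable] = quasi_metric_kernel_measurable[OF K]
  have "dint K A B = (\<integral>\<^sup>+ y. \<integral>\<^sup>+ x. indicator A x * (indicator B y * K (x, y)) \<partial>lborel \<partial>lborel)"
    unfolding dint_def by (rule lborel_pair.Fubini'[symmetric]) measurable
  also have "\<dots> = dint K B A"
    using K unfolding dint_def quasi_metric_kernel_def
    by (intro nn_integral_cong) (metis mult.left_commute)
  finally show ?thesis .
qed

text \<open>The triangle inequality, averaged over the intermediate point in \<open>W\<close>.\<close>

lemma dint_chain:
  assumes K: "quasi_metric_kernel c K"
    and [measurable]: "A \<in> sets borel" "B \<in> sets borel" "W \<in> sets borel"
  shows "emeasure lborel W * dint K A B
         \<le> ennreal c * (emeasure lborel B * dint K A W + emeasure lborel A * dint K W B)"
proof -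
  note [measurable] = quasi_metric_kernel_measurable[OF K]
  \<comment> \<open>The factor \<open>emeasure lborel W\<close> is written as an integral over an
    auxiliary point \<open>z\<close> of \<open>W\<close>, at which the triangle inequality is then
    applied.\<close>
  have "emeasure lborel W * dint K A B
    = (\<integral>\<^sup>+ x. \<integral>\<^sup>+ y. \<integral>\<^sup>+ z. indicator A x * (indicator B y * (indicator W z * K (x, y)))
        \<partial>lborel \<partial>lborel \<partial>lborel)"
  proof -
    have "(\<integral>\<^sup>+ z. indicator A x * (indicator B y * (indicator W z * K (x, y))) \<partial>lborel)
        = emeasure lborel W * (indicator A x * (indicator B y * K (x, y)))" for x y
      by (simp add: nn_integral_cmult nn_integral_multc mult_ac)
    then show ?thesis
      unfolding dint_def by (simp add: nn_integral_cmult)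
  qed
  also have "\<dots> \<le> (\<integral>\<^sup>+ x. \<integral>\<^sup>+ y. \<integral>\<^sup>+ z. 
      ennreal c * (indicator A x * (indicator B y * (indicator W z * K (x, z)))
      + indicator A x * (indicator B y * (indicator W z * K (z, y)))) \<partial>lborel \<partial>lborel \<partial>lborel)"
    using K unfolding quasi_metric_kernel_def
    by (intro nn_integral_mono) (auto simp: indicator_def)
  also have "\<dots> = ennreal c * ((\<integral>\<^sup>+ x. \<integral>\<^sup>+ y. \<integral>\<^sup>+ z. indicator A x * (indicator B y * (indicator W z * K (x, z)))
       \<partial>lborel \<partial>lborel \<partial>lborel)
      + (\<integral>\<^sup>+ x. \<integral>\<^sup>+ y. \<integral>\<^sup>+ z. indicator A x * (indicator B y * (indicator W z * K (z, y)))
        \<partial>lborel \<partial>lborel \<partial>lborel))"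
    by (simp add: nn_integral_cmult nn_integral_add)
  also have "(\<integral>\<^sup>+ x. \<integral>\<^sup>+ y. \<integral>\<^sup>+ z. indicator A x * (indicator B y * (indicator W z * K (x, z)))
       \<partial>lborel \<partial>lborel \<partial>lborel) = emeasure lborel B * dint K A W"
  proof -
    have "(\<integral>\<^sup>+ y. \<integral>\<^sup>+ z. indicator A x * (indicator B y * (indicator W z * K (x, z))) \<partial>lborel \<partial>lborel)
       = emeasure lborel B * (\<integral>\<^sup>+ z. indicator A x * (indicator W z * K (x, z)) \<partial>lborel)" for x
    proof -
      have "(\<integral>\<^sup>+ y. \<integral>\<^sup>+ z. indicator A x * (indicator B y * (indicator W z * K (x, z))) \<partial>lborel \<partial>lborel)
       = (\<integral>\<^sup>+ y. \<integral>\<^sup>+ z. indicator B y * (indicator A x * (indicator W z * K (x, z))) \<partial>lborel \<partial>lborel)"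
        by (simp add: mult_ac)
      also have "\<dots> = (\<integral>\<^sup>+ y. indicator B y * (\<integral>\<^sup>+ z. indicator A x * (indicator W z * K (x, z)) \<partial>lborel) \<partial>lborel)"
        by (intro nn_integral_cong nn_integral_cmult) measurable
      also have "\<dots> = emeasure lborel B * (\<integral>\<^sup>+ z. indicator A x * (indicator W z * K (x, z)) \<partial>lborel)"
        by (subst nn_integral_multc) auto
      finally show ?thesis .
    qed
    then show ?thesis
      unfolding dint_def by (simp add: nn_integral_cmult)
  qed
  also have "(\<integral>\<^sup>+ x. \<integral>\<^sup>+ y. \<integral>\<^sup>+ z. indicator A x * (indicator B y * (indicator W z * K (z, y)))
        \<partial>lborel \<partial>lborel \<partial>lborel) = emeasure lborel A * dint K W B"
  proof -
    have "(\<integral>\<^sup>+ y. \<integral>\<^sup>+ z. indicator A x * (indicator B y * (indicator W z * K (z, y))) \<partial>lborel \<partial>lborel)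
       = indicator A x * (\<integral>\<^sup>+ y. \<integral>\<^sup>+ z. indicator W z * (indicator B y * K (z, y)) \<partial>lborel \<partial>lborel)" for x
      by (simp add: nn_integral_cmult mult_ac)
    moreover have "(\<integral>\<^sup>+ y. \<integral>\<^sup>+ z. indicator W z * (indicator B y * K (z, y)) \<partial>lborel \<partial>lborel) = dint K W B"
      unfolding dint_def by (rule lborel_pair.Fubini') measurable
    ultimately show ?thesis
      by (simp add: nn_integral_multc)
  qed
  finally show ?thesis .
qed

text \<open>The compact closure is covered by balls centred in \<open>\<Omega>\<close> itself, so
  that the pieces used later contain their centres and have positive measure.\<close>

lemma finite_cover_balls:
  fixes \<Omega> :: "'a::euclidean_space set"
  assumes "bounded \<Omega>" "\<epsilon> > 0"
  obtains k where "finite k" "k \<subseteq> \<Omega>" "\<Omega> \<subseteq> (\<Union>x\<in>k. ball x \<epsilon>)"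
proof -
  have "compact (closure \<Omega>)" using assms by simp
  moreover have "closure \<Omega> \<subseteq> (\<Union>x\<in>\<Omega>. ball x \<epsilon>)"
    using assms by (auto simp: closure_approachable)
  ultimately obtain k where "k \<subseteq> \<Omega>" "finite k" "closure \<Omega> \<subseteq> (\<Union>x\<in>k. ball x \<epsilon>)"
    using compactE_image[of "closure \<Omega>" \<Omega> "\<lambda>x. ball x \<epsilon>" thesis] open_ball by blast
  then show ?thesis using that closure_subset[of \<Omega>] by blast
qed

lemma measure_open_bounded_pos:
  fixes S :: "'a::euclidean_space set"
  assumes "open S" "bounded S" "S \<noteq> {}"
  shows "measure lborel S > 0"
proof -
  obtain x e where e: "e > 0" "ball x e \<subseteq> S"
    using assms by (meson ex_in_conv openE)
  have "0 < measure lborel (ball x e)"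
    using e by (intro content_ball_pos)
  also have "\<dots> \<le> measure lborel S"
    using e assms emeasure_bounded_finite[of S]
    by (intro measure_mono_fmeasurable) (auto simp: fmeasurable_def)
  finally show ?thesis .
qed

text \<open>Division by a positive real weight is done by multiplying with its reciprocal, which
  remains valid when \<open>D\<close> or \<open>E\<close> is infinite.\<close>

lemma ennreal_le_divide:
  assumes "ennreal w * D \<le> ennreal k * E" "w > 0" "k \<ge> 0"
  shows "D \<le> ennreal (k / w) * E"
proof -
  have "D = ennreal (1 / w) * (ennreal w * D)"
    using assms by (simp add: mult.assoc[symmetric] ennreal_mult[symmetric])
  also have "\<dots> \<le> ennreal (1 / w) * (ennreal k * E)"
    by (intro mult_left_mono assms) auto
  also have "\<dots> = ennreal (k / w) * E"
    using assms by (simp add: mult.assoc[symmetric] ennreal_mult[symmetric])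
  finally show ?thesis .
qed

text \<open>Nearby pieces interact within range \<open>r\<close>, and the averaged triangle
  inequality passes from neighbours to any two pieces. The constant is chosen before
  \<open>K\<close>, so it does not depend on the function behind the kernel.\<close>

lemma dint_le_dint_near:
  fixes \<Omega> :: "'a::euclidean_space set"
  assumes op: "open \<Omega>" and conn: "connected \<Omega>" and bdd: "bounded \<Omega>" and r: "r > 0" and c: "c \<ge> 0"
  shows "\<exists>C\<ge>0. \<forall>K. quasi_metric_kernel c K \<longrightarrow> dint K \<Omega> \<Omega> \<le> ennreal C * dint_near r K \<Omega>"
proof -
  define B where "B x = \<Omega> \<inter> ball x (r / 4)" for x
  define R where "R x y \<longleftrightarrow> (\<exists>C\<ge>0. \<forall>K. quasi_metric_kernel c K \<longrightarrow> dint K (B x) (B y) \<le> ennreal C * dint_near r K \<Omega>)"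
    for x y
  have B_op: "open (B x)" for x
    using op by (auto simp: B_def)
  have B_meas[measurable]: "B x \<in> sets borel" for x
    using B_op by simp
  have \<Omega>_meas[measurable]: "\<Omega> \<in> sets borel"
    using op by simp
  have B_bdd: "bounded (B x)" for x
    by (auto simp: B_def)
  have B_em: "emeasure lborel (B x) = ennreal (measure lborel (B x))" for x
    using emeasure_bounded_finite[OF B_bdd[of x]] by (intro emeasure_eq_ennreal_measure) auto
  have B_pos: "measure lborel (B x) > 0" if "x \<in> \<Omega>" for x
  proof -
    have "x \<in> B x" using that r by (auto simp: B_def)
    then show ?thesis
      using B_op B_bdd by (intro measure_open_bounded_pos) auto
  qed
  \<comment> \<open>\<open>R\<close> is an equivalence relation with open classes, so it is trivial on a connected set.\<close>
  have R: "R a b" if "a \<in> \<Omega>" "b \<in> \<Omega>" for a b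
  proof (rule connected_equivalence_relation[OF conn that, of R])
    fix x y assume "R x y"
    then show "R y x" unfolding R_def using dint_sym[OF _ B_meas B_meas] by metis
  next
    fix x y z assume "R x y" "R y z" and y: "y \<in> \<Omega>"
    obtain C1 where C1: "C1 \<ge> 0"
      "\<And>K. quasi_metric_kernel c K \<Longrightarrow> dint K (B x) (B y) \<le> ennreal C1 * dint_near r K \<Omega>"
      using \<open>R x y\<close> unfolding R_def by blast
    obtain C2 where C2: "C2 \<ge> 0"
      "\<And>K. quasi_metric_kernel c K \<Longrightarrow> dint K (B y) (B z) \<le> ennreal C2 * dint_near r K \<Omega>"
      using \<open>R y z\<close> unfolding R_def by blast
    \<comment> \<open>These are the coefficients of \<open>dint_chain\<close> with
      \<open>B y\<close> as the set of intermediate points; positivity of its measure permits the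
      division below.\<close>
    define k where "k = c * (measure lborel (B z) * C1 + measure lborel (B x) * C2)"
    have k: "k \<ge> 0" using c C1(1) C2(1) by (simp add: k_def)
    have "dint K (B x) (B z) \<le> ennreal (k / measure lborel (B y)) * dint_near r K \<Omega>"
      if K: "quasi_metric_kernel c K" for K
    proof (rule ennreal_le_divide[OF _ B_pos[OF y] k])
      have "ennreal (measure lborel (B y)) * dint K (B x) (B z)
        \<le> ennreal c * (ennreal (measure lborel (B z)) * dint K (B x) (B y) + ennreal (measure lborel (B x)) * dint K (B y) (B z))"
        using dint_chain[OF K B_meas[of x] B_meas[of z] B_meas[of y]] by (simp add: B_em)
      also have "\<dots> \<le> ennreal c * (ennreal (measure lborel (B z)) * (ennreal C1 * dint_near r K \<Omega>)
          + ennreal (measure lborel (B x)) * (ennreal C2 * dint_near r K \<Omega>))"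
        by (intro mult_left_mono add_mono C1 C2 K) auto
      also have "\<dots> = ennreal k * dint_near r K \<Omega>"
        using c C1(1) C2(1) unfolding k_def
        by (simp add: ennreal_mult distrib_left distrib_right mult_ac)
      finally show "ennreal (measure lborel (B y)) * dint K (B x) (B z) \<le> ennreal k * dint_near r K \<Omega>" .
    qed
    then show "R x z"
      unfolding R_def using k by (intro exI[of _ "k / measure lborel (B y)"]) auto
  next
    fix a assume a: "a \<in> \<Omega>"
    have "R a x" if "x \<in> B a" for x
    proof -
      \<comment> \<open>Three distances below \<open>r / 4\<close> lead from \<open>u\<close>
        through \<open>a\<close> and \<open>x\<close> to \<open>v\<close>, so the total stays below
        \<open>r\<close>.\<close>
      have dist: "v \<in> ball u r" if "u \<in> B a" "v \<in> B x" for u v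
      proof -
        have "dist u v \<le> dist a u + (dist a x + dist x v)"
          by (metis add_left_mono dist_commute dist_triangle dist_triangle_le order_trans)
        then show ?thesis using that \<open>x \<in> B a\<close> r by (simp add: B_def)
      qed
      have "dint K (B a) (B x) \<le> dint_near r K \<Omega>" for K
        unfolding dint_def dint_near_def
        by (intro nn_integral_mono) (use dist in \<open>auto simp: indicator_def B_def\<close>)
      then show ?thesis
        unfolding R_def by (intro exI[of _ 1]) auto
    qed
    moreover have "openin (top_of_set \<Omega>) (B a)"
      unfolding B_def by (intro openin_open_Int) auto
    moreover have "a \<in> B a" using a r by (simp add: B_def)
    ultimately show "\<exists>T. openin (top_of_set \<Omega>) T \<and> a \<in> T \<and> (\<forall>x\<in>T. R a x)"
      by blast
  qed
  obtain k where k: "finite k" "k \<subseteq> \<Omega>" "\<Omega> \<subseteq> (\<Union>x\<in>k. ball x (r / 4))"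
    using finite_cover_balls[OF bdd, of "r / 4"] r by auto
  have "\<forall>x y. \<exists>C. x \<in> k \<longrightarrow> y \<in> k \<longrightarrow> C \<ge> 0 \<and> (\<forall>K. quasi_metric_kernel c K \<longrightarrow> dint K (B x) (B y) \<le> ennreal C * dint_near r K \<Omega>)"
    using R k(2) unfolding R_def by blast
  then obtain C where C: "\<And>x y. x \<in> k \<Longrightarrow> y \<in> k \<Longrightarrow> C x y \<ge> (0::real)"
    "\<And>x y K. x \<in> k \<Longrightarrow> y \<in> k \<Longrightarrow> quasi_metric_kernel c K \<Longrightarrow> dint K (B x) (B y) \<le> ennreal (C x y) * dint_near r K \<Omega>"
    by metis
  have "dint K \<Omega> \<Omega> \<le> ennreal (\<Sum>x\<in>k. \<Sum>y\<in>k. C x y) * dint_near r K \<Omega>" if K: "quasi_metric_kernel c K" for K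
  proof -
    note [measurable] = quasi_metric_kernel_measurable[OF K]
    \<comment> \<open>The pieces may overlap; an inequality between indicators is enough because the
      kernel is nonnegative.\<close>
    have ind: "indicator \<Omega> u \<le> (\<Sum>x\<in>k. indicator (B x) u :: ennreal)" for u
    proof (cases "u \<in> \<Omega>")
      case True
      then obtain x where "x \<in> k" "u \<in> B x" using k(3) by (auto simp: B_def)
      then show ?thesis
        using member_le_sum[of x k "\<lambda>x. indicator (B x) u :: ennreal"] k(1) by (simp add: indicator_def split: if_splits)
    qed auto
    have "dint K \<Omega> \<Omega> \<le> (\<integral>\<^sup>+ u. \<integral>\<^sup>+ v. (\<Sum>x\<in>k. indicator (B x) u) * ((\<Sum>y\<in>k. indicator (B y) v) * K (u, v)) \<partial>lborel \<partial>lborel)"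
      unfolding dint_def by (intro nn_integral_mono mult_mono ind) auto
    also have "\<dots> = (\<Sum>x\<in>k. \<Sum>y\<in>k. dint K (B x) (B y))"
      by (simp add: dint_def sum_distrib_left sum_distrib_right nn_integral_sum) (rule sum.swap)
    also have "\<dots> \<le> (\<Sum>x\<in>k. \<Sum>y\<in>k. ennreal (C x y) * dint_near r K \<Omega>)"
      by (intro sum_mono C K)
    also have "\<dots> = ennreal (\<Sum>x\<in>k. \<Sum>y\<in>k. C x y) * dint_near r K \<Omega>"
      using C(1) by (simp add: sum_distrib_right[symmetric] sum_ennreal sum_nonneg)
    finally show ?thesis .
  qed
  moreover have "0 \<le> (\<Sum>x\<in>k. \<Sum>y\<in>k. C x y)"
    using C(1) by (intro sum_nonneg) auto
  ultimately show ?thesis by blast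
qed

section \<open>The Luxemburg seminorm\<close>

text \<open>Made for infima such as the Luxemburg functional: an estimate at every real level
  strictly above \<open>y\<close> passes to \<open>y\<close> itself, whether or not the infimum is
  attained.\<close>

lemma ennreal_le_cmultI:
  assumes "\<And>l. y < ennreal l \<Longrightarrow> x \<le> ennreal (C * l)" and C: "C \<ge> 0" and y: "y < top"
  shows "x \<le> ennreal C * y"
proof -
  obtain A where A: "A \<ge> 0" "y = ennreal A"
    using y by (cases y) auto
  have "x \<le> ennreal C * ennreal A + ennreal e" if e: "e > 0" for e
  proof -
    \<comment> \<open>The denominator \<open>C + 1\<close> keeps the excess below \<open>e\<close>
      and also covers \<open>C = 0\<close>.\<close>
    have "x \<le> ennreal (C * (A + e / (C + 1)))"
      using C e A by (intro assms) (auto simp: ennreal_less_iff)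
    also have "\<dots> \<le> ennreal (C * A + e)"
      using C e by (intro ennreal_leI) (simp add: field_simps)
    also have "\<dots> = ennreal C * ennreal A + ennreal e"
      using C e A by (simp add: ennreal_mult)
    finally show ?thesis .
  qed
  then show ?thesis
    unfolding A(2) by (rule ennreal_le_epsilon)
qed

section \<open>Local integrability, cosets and elementary inequalities for powers\<close>

lemma L1loc_cmult: "L1loc \<Omega> u \<Longrightarrow> L1loc \<Omega> (\<lambda>x. c * u x)"
  by (auto simp: L1loc_def)

lemma L1loc_divide: "L1loc \<Omega> u \<Longrightarrow> L1loc \<Omega> (\<lambda>x. u x / c)"
  using L1loc_cmult[of \<Omega> u "inverse c"] by (simp add: field_simps)

lemma L1loc_diff: "L1loc \<Omega> u \<Longrightarrow> L1loc \<Omega> v \<Longrightarrow> L1loc \<Omega> (\<lambda>x. u x - v x)"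
  by (auto simp: L1loc_def intro!: set_integral_diff)

lemma perp_part_eq: "perp_part \<Omega> u = (\<lambda>x. u x + (- mean_val \<Omega> u))"
  by (simp add: perp_part_def)

lemma coset_eq_perp: "coset_eq \<Omega> (perp_part \<Omega> u) u"
  by (auto simp: coset_eq_def perp_part_def)

lemma coset_eq_add_const: "coset_eq \<Omega> (\<lambda>x. u x + c) u"
  by (auto simp: coset_eq_def)

text \<open>The crude estimate through \<open>s + t \<le> 2 * max s t\<close>; it supplies the
  quasi-triangle constant \<open>2 powr p\<close> used throughout.\<close>

lemma powr_add_le:
  fixes s t p :: real
  assumes "s \<ge> 0" "t \<ge> 0" "p \<ge> 0"
  shows "(s + t) powr p \<le> 2 powr p * (s powr p + t powr p)"
proof -
  have "(s + t) powr p \<le> (2 * max s t) powr p"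
    using assms by (intro powr_mono2) auto
  also have "\<dots> = 2 powr p * max s t powr p"
    using assms by (simp add: powr_mult)
  also have "\<dots> \<le> 2 powr p * (s powr p + t powr p)"
    by (intro mult_left_mono) (auto simp: max_def)
  finally show ?thesis .
qed

lemma cmod_add_powr_le:
  assumes "p \<ge> 0"
  shows "cmod (x + y) powr p \<le> 2 powr p * (cmod x powr p + cmod y powr p)"
  using assms
  by (intro order_trans[OF powr_mono2[OF _ _ norm_triangle_ineq] powr_add_le]) auto

lemma quasi_metric_kernel_powr:
  fixes w :: "'a::euclidean_space \<Rightarrow> complex"
  assumes [measurable]: "w \<in> borel_measurable borel" and p: "p \<ge> 0"
  shows "quasi_metric_kernel (2 powr p) (\<lambda>z. ennreal (cmod (w (fst z) - w (snd z)) powr p))"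
  unfolding quasi_metric_kernel_def
proof (intro conjI allI)
  show "(\<lambda>z. ennreal (cmod (w (fst z) - w (snd z)) powr p)) \<in> borel_measurable (borel \<Otimes>\<^sub>M borel)"
    by measurable
  fix x y z
  show "ennreal (cmod (w (fst (x, y)) - w (snd (x, y))) powr p) = ennreal (cmod (w (fst (y, x)) - w (snd (y, x))) powr p)"
    by (simp add: norm_minus_commute)
  have "cmod (w x - w y) powr p \<le> 2 powr p * (cmod (w x - w z) powr p + cmod (w z - w y) powr p)"
    using cmod_add_powr_le[OF p, of "w x - w z" "w z - w y"] by simp
  then have "ennreal (cmod (w x - w y) powr p) \<le> ennreal (2 powr p * (cmod (w x - w z) powr p + cmod (w z - w y) powr p))"
    by (rule ennreal_leI)
  then show "ennreal (cmod (w (fst (x, y)) - w (snd (x, y))) powr p)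
    \<le> ennreal (2 powr p) * (ennreal (cmod (w (fst (x, z)) - w (snd (x, z))) powr p)
      + ennreal (cmod (w (fst (z, y)) - w (snd (z, y))) powr p))"
    by (simp add: ennreal_mult)
qed

text \<open>On a domain of finite measure this takes the place of Hoelder's inequality for embedding
  \<open>L_p\<close> into \<open>L_1\<close>.\<close>

lemma le_one_plus_powr:
  fixes t p :: real
  assumes "t \<ge> 0" "p \<ge> 1"
  shows "t \<le> 1 + t powr p"
proof (cases "t \<le> 1")
  case False
  then show ?thesis using powr_mono[of 1 p t] assms by simp
qed (use assms in \<open>simp add: add_increasing2\<close>)

text \<open>Packages the consequences of the hypotheses on which the analysis rests: a.e. convexity
  and continuity of the integrand, its growth from below with exponent \<open>p = p_-\<close> and
  constant \<open>k\<close>, and the lower bound \<open>c0\<close> for \<open>a\<close> on the ball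
  of radius \<open>r\<close>.\<close>

locale nonlocal_energy =
  fixes \<Omega> :: "'a::euclidean_space set" and a :: "'a \<Rightarrow> real"
    and \<phi> :: "real \<Rightarrow> 'a \<Rightarrow> 'a \<Rightarrow> real" and p r c0 k :: real
  assumes open_dom: "open \<Omega>" and connected_dom: "connected \<Omega>" and dom_ne: "\<Omega> \<noteq> {}"
    and bounded_dom: "bounded \<Omega>" and p_gt_1: "p > 1"
    and a_meas: "a \<in> borel_measurable lebesgue" and a_nonneg: "\<And>z. a z \<ge> 0"
    and r_pos: "r > 0" and c0_pos: "c0 > 0"
    and a_ge: "AE z in lebesgue. z \<in> ball 0 r \<longrightarrow> a z \<ge> c0"
    and \<phi>_nonneg: "\<And>t x y. t \<ge> 0 \<Longrightarrow> x \<in> \<Omega> \<Longrightarrow> y \<in> \<Omega> \<Longrightarrow> \<phi> t x y \<ge> 0"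
    and \<phi>_meas: "C1 \<phi> \<Omega>" and k_nonneg: "k \<ge> 0"
    and \<phi>_convex_ae: "AE z in lebesgue. z \<in> \<Omega> \<times> \<Omega> \<longrightarrow>
       \<phi> 0 (fst z) (snd z) = 0 \<and> convex_on {0..} (\<lambda>t. \<phi> t (fst z) (snd z)) \<and>
       continuous_on {0..} (\<lambda>t. \<phi> t (fst z) (snd z))"
    and coercive_ae: "AE z in lebesgue. z \<in> \<Omega> \<times> \<Omega> \<longrightarrow>
       (\<forall>t\<ge>0. t powr p \<le> 1 + k * \<phi> t (fst z) (snd z))"
begin

abbreviation "F \<equiv> Fint \<phi> a \<Omega>"
abbreviation "lnorm \<equiv> lux \<phi> a \<Omega>"

definition dens :: "('a \<Rightarrow> complex) \<Rightarrow> 'a \<times> 'a \<Rightarrow> ennreal" where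
  "dens u z = indicator (\<Omega> \<times> \<Omega>) z *
     ennreal (\<phi> (cmod (u (fst z) - u (snd z))) (fst z) (snd z) * a (fst z - snd z))"

lemma Fint_eq_dens: "F u = (\<integral>\<^sup>+ z. dens u z \<partial>lebesgue)"
  by (simp add: Fint_def dens_def)

text \<open>(C1) speaks of the measure restricted to \<open>\<Omega> \<times> \<Omega>\<close>;
  extension by zero turns it into measurability on the whole product, where the factor
  \<open>a(x - y)\<close> lives.\<close>

lemma dens_measurable:
  assumes "L1loc \<Omega> u"
  shows "dens u \<in> borel_measurable lebesgue"
proof -
  have "\<Omega> \<times> \<Omega> \<in> sets lebesgue"
    using open_dom by (intro sets_completionI_sets) (auto intro!: borel_open open_Times)
  then have "(\<lambda>z. indicator (\<Omega> \<times> \<Omega>) z *\<^sub>R \<phi> (cmod (u (fst z) - u (snd z))) (fst z) (snd z))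
      \<in> borel_measurable lebesgue"
    using \<phi>_meas assms by (subst borel_measurable_restrict_space_iff[symmetric]) (auto simp: C1_def)
  then have "(\<lambda>z. ennreal ((indicator (\<Omega> \<times> \<Omega>) z *\<^sub>R \<phi> (cmod (u (fst z) - u (snd z))) (fst z) (snd z))
      * a (fst z - snd z))) \<in> borel_measurable lebesgue"
    by (intro measurable_compose[OF _ measurable_ennreal] borel_measurable_times
        borel_measurable_lebesgue_diff a_meas)
  also have "(\<lambda>z. ennreal ((indicator (\<Omega> \<times> \<Omega>) z *\<^sub>R \<phi> (cmod (u (fst z) - u (snd z))) (fst z) (snd z))
      * a (fst z - snd z))) = dens u"
    by (auto simp: dens_def fun_eq_iff split: split_indicator)
  finally show ?thesis .
qed

lemma \<phi>_mono_ae: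
  "AE z in lebesgue. z \<in> \<Omega> \<times> \<Omega> \<longrightarrow> (\<forall>s t. 0 \<le> s \<longrightarrow> s \<le> t \<longrightarrow> \<phi> s (fst z) (snd z) \<le> \<phi> t (fst z) (snd z))"
  using \<phi>_convex_ae
proof eventually_elim
  case (elim z)
  then show ?case
    using convex_on_nonneg_mono[of "\<lambda>t. \<phi> t (fst z) (snd z)"] \<phi>_nonneg[of _ "fst z" "snd z"]
    by (auto simp: mem_Times_iff)
qed

lemma Fint_mono:
  assumes "AE z in lebesgue. z \<in> \<Omega> \<times> \<Omega> \<longrightarrow> cmod (u (fst z) - u (snd z)) \<le> cmod (v (fst z) - v (snd z))"
  shows "F u \<le> F v"
  unfolding Fint_eq_dens
proof (rule nn_integral_mono_AE)
  show "AE z in lebesgue. dens u z \<le> dens v z"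
    using assms \<phi>_mono_ae
    by eventually_elim (auto simp: dens_def split: split_indicator intro!: ennreal_leI mult_right_mono a_nonneg)
qed

section \<open>Seminorm properties and lower semicontinuity of the Luxemburg functional\<close>

lemma lux_leI:
  assumes "l > 0" "F (\<lambda>x. u x / complex_of_real l) \<le> 1"
  shows "lnorm u \<le> ennreal l"
  unfolding lux_def using assms by (intro Inf_lower) auto

text \<open>The admissible levels form an upward closed set, because \<open>F (u / l)\<close>
  decreases in \<open>l\<close>. Hence every level strictly above the infimum is admissible.\<close>

lemma lux_lessD:
  assumes "lnorm u < ennreal l"
  shows "l > 0" "F (\<lambda>x. u x / complex_of_real l) \<le> 1"
proof -
  obtain m where m: "m > 0" "F (\<lambda>x. u x / complex_of_real m) \<le> 1" "ennreal m < ennreal l"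
    using assms unfolding lux_def Inf_less_iff by auto
  then have "m < l"
    by (metis ennreal_leI linorder_not_le)
  then show "l > 0" using m(1) by simp
  have "F (\<lambda>x. u x / complex_of_real l) \<le> F (\<lambda>x. u x / complex_of_real m)"
    using m(1) \<open>m < l\<close>
    by (intro Fint_mono AE_I2) (auto simp: norm_divide diff_divide_distrib[symmetric] intro!: divide_left_mono)
  then show "F (\<lambda>x. u x / complex_of_real l) \<le> 1" using m(2) by order
qed

text \<open>Only the increments of \<open>u\<close> and \<open>v\<close> are compared, so invariance
  under adding constants and under a change of sign both follow from this one statement.\<close>

lemma lux_mono:
  assumes "AE z in lebesgue. z \<in> \<Omega> \<times> \<Omega> \<longrightarrow> cmod (u (fst z) - u (snd z)) \<le> cmod (v (fst z) - v (snd z))"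
  shows "lnorm u \<le> lnorm v"
  unfolding lux_def
proof (rule Inf_superset_mono, safe)
  fix l :: real assume l: "l > 0" "F (\<lambda>x. v x / complex_of_real l) \<le> 1"
  have "F (\<lambda>x. u x / complex_of_real l) \<le> F (\<lambda>x. v x / complex_of_real l)"
  proof (rule Fint_mono)
    show "AE z in lebesgue. z \<in> \<Omega> \<times> \<Omega> \<longrightarrow> cmod (u (fst z) / complex_of_real l - u (snd z) / complex_of_real l)
      \<le> cmod (v (fst z) / complex_of_real l - v (snd z) / complex_of_real l)"
      using assms l(1)
      by eventually_elim (auto simp: norm_divide diff_divide_distrib[symmetric] intro!: divide_right_mono)
  qed
  then show "\<exists>lam. ennreal l = ennreal lam \<and> 0 < lam \<and> F (\<lambda>x. u x / complex_of_real lam) \<le> 1"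
    using l by (intro exI[of _ l]) auto
qed

lemma lux_coset_eq:
  assumes "coset_eq \<Omega> u v"
  shows "lnorm u = lnorm v"
proof -
  obtain c where "AE x in lebesgue. x \<in> \<Omega> \<longrightarrow> u x - v x = c"
    using assms by (auto simp: coset_eq_def)
  then have "AE x in lebesgue. x \<in> \<Omega> \<longrightarrow> u x = v x + c"
    by eventually_elim (auto simp: algebra_simps)
  from AE_lebesgue_fst[OF this] AE_lebesgue_snd[OF this]
  have "AE z in (lebesgue :: ('a \<times> 'a) measure). z \<in> \<Omega> \<times> \<Omega> \<longrightarrow> u (fst z) - u (snd z) = v (fst z) - v (snd z)"
    by eventually_elim auto
  then show ?thesis
    by (intro antisym lux_mono) (auto elim!: eventually_mono)
qed

text \<open>All increments vanish and \<open>\<phi> 0\<close> is zero a.e., so every positive level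
  is admissible.\<close>

lemma lux_const: "lnorm (\<lambda>x. c) = 0"
proof -
  have "F (\<lambda>x. c / complex_of_real l) = (\<integral>\<^sup>+ z. 0 \<partial>(lebesgue :: ('a \<times> 'a) measure))" for l
    unfolding Fint_eq_dens
    by (rule nn_integral_cong_AE) (use \<phi>_convex_ae in eventually_elim, auto simp: dens_def split: split_indicator)
  then have "lnorm (\<lambda>x. c) \<le> ennreal l" if "l > 0" for l
    using that by (intro lux_leI) auto
  then have "lnorm (\<lambda>x. c) \<le> 0 + ennreal l" if "l > 0" for l
    using that by simp
  then have "lnorm (\<lambda>x. c) \<le> 0"
    by (rule ennreal_le_epsilon)
  then show ?thesis by simp
qed

lemma lux_cmult_le:
  assumes "lnorm u < top" "c \<noteq> 0"
  shows "lnorm (\<lambda>x. c * u x) \<le> ennreal (cmod c) * lnorm u"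
proof (rule ennreal_le_cmultI)
  fix l assume "lnorm u < ennreal l"
  note l = lux_lessD[OF this]
  have "F (\<lambda>x. c * u x / complex_of_real (cmod c * l)) \<le> F (\<lambda>x. u x / complex_of_real l)"
    using l(1) assms
    by (intro Fint_mono AE_I2) (auto simp: norm_divide norm_mult diff_divide_distrib[symmetric] right_diff_distrib[symmetric])
  then show "lnorm (\<lambda>x. c * u x) \<le> ennreal (cmod c * l)"
    using l assms by (intro lux_leI) auto
qed (use assms in auto)

text \<open>The reverse inequality is \<open>lux_cmult_le\<close> applied to the factor
  \<open>inverse c\<close> and the function \<open>c * u\<close>.\<close>

lemma lux_cmult:
  assumes "lnorm u < top"
  shows "lnorm (\<lambda>x. c * u x) = ennreal (cmod c) * lnorm u"
proof (cases "c = 0")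
  case True
  then show ?thesis using lux_const[of 0] by simp
next
  case False
  have le: "lnorm (\<lambda>x. c * u x) \<le> ennreal (cmod c) * lnorm u"
    using lux_cmult_le[OF assms False] .
  also have "\<dots> < top"
    using assms by (simp add: ennreal_mult_less_top)
  finally have "lnorm (\<lambda>x. inverse c * (c * u x)) \<le> ennreal (cmod (inverse c)) * lnorm (\<lambda>x. c * u x)"
    using False by (intro lux_cmult_le) auto
  then have "ennreal (cmod c) * lnorm u \<le> ennreal (cmod c) * (ennreal (cmod (inverse c)) * lnorm (\<lambda>x. c * u x))"
    using False by (intro mult_left_mono) (auto simp: mult.assoc[symmetric])
  also have "\<dots> = lnorm (\<lambda>x. c * u x)"
    using False by (simp add: mult.assoc[symmetric] ennreal_mult[symmetric] norm_inverse)
  finally show ?thesis using le by order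
qed

text \<open>Monotonicity of the integrand absorbs the triangle inequality for the increments;
  convexity then separates the two terms.\<close>

lemma Fint_convex_comb:
  assumes u: "L1loc \<Omega> u" and v: "L1loc \<Omega> v" and l: "0 \<le> l" "l \<le> 1"
  shows "F (\<lambda>x. complex_of_real (1 - l) * u x + complex_of_real l * v x) \<le> ennreal (1 - l) * F u + ennreal l * F v"
proof -
  have "F (\<lambda>x. complex_of_real (1 - l) * u x + complex_of_real l * v x) \<le> (\<integral>\<^sup>+ z. ennreal (1 - l) * dens u z + ennreal l * dens v z \<partial>lebesgue)"
    unfolding Fint_eq_dens
  proof (rule nn_integral_mono_AE)
    show "AE z in lebesgue. dens (\<lambda>x. complex_of_real (1 - l) * u x + complex_of_real l * v x) z \<le> ennreal (1 - l) * dens u z + ennreal l * dens v z"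
      using \<phi>_convex_ae \<phi>_mono_ae
    proof eventually_elim
      case (elim z)
      show ?case
      proof (cases "z \<in> \<Omega> \<times> \<Omega>")
        case True
        define s where "s = cmod (u (fst z) - u (snd z))"
        define t where "t = cmod (v (fst z) - v (snd z))"
        let ?f = "\<lambda>t. \<phi> t (fst z) (snd z)"
        have st: "s \<ge> 0" "t \<ge> 0" by (auto simp: s_def t_def)
        then have pos: "?f s \<ge> 0" "?f t \<ge> 0"
          using \<phi>_nonneg True by (auto simp: mem_Times_iff)
        let ?d = "cmod (complex_of_real (1 - l) * u (fst z) + complex_of_real l * v (fst z)
          - (complex_of_real (1 - l) * u (snd z) + complex_of_real l * v (snd z)))"
        have "?d = cmod (complex_of_real (1 - l) * (u (fst z) - u (snd z)) + complex_of_real l * (v (fst z) - v (snd z)))"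
          by (simp add: algebra_simps)
        also have "\<dots> \<le> (1 - l) * s + l * t"
          using l unfolding s_def t_def
          by (intro order_trans[OF norm_triangle_ineq]) (simp add: norm_mult del: of_real_diff)
        finally have "?f ?d \<le> ?f ((1 - l) * s + l * t)"
          using elim True by simp
        also have "\<dots> \<le> (1 - l) * ?f s + l * ?f t"
          using convex_onD[of "{0..}" ?f l s t] elim True l st by auto
        finally have "?f ?d * a (fst z - snd z) \<le> ((1 - l) * ?f s + l * ?f t) * a (fst z - snd z)"
          by (intro mult_right_mono a_nonneg)
        then have "ennreal (?f ?d * a (fst z - snd z))
            \<le> ennreal ((1 - l) * (?f s * a (fst z - snd z)) + l * (?f t * a (fst z - snd z)))"
          by (intro ennreal_leI) (simp add: algebra_simps)
        also have "\<dots> = ennreal (1 - l) * ennreal (?f s * a (fst z - snd z)) + ennreal l * ennreal (?f t * a (fst z - snd z))"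
          using l pos a_nonneg[of "fst z - snd z"] by (simp add: ennreal_mult)
        finally show ?thesis
          using True by (simp add: dens_def s_def t_def del: of_real_diff)
      qed (simp add: dens_def)
    qed
  qed
  also have "\<dots> = ennreal (1 - l) * F u + ennreal l * F v"
    unfolding Fint_eq_dens using dens_measurable[OF u] dens_measurable[OF v]
    by (simp add: nn_integral_add nn_integral_cmult)
  finally show ?thesis .
qed

lemma lux_triangle:
  assumes u: "L1loc \<Omega> u" and v: "L1loc \<Omega> v"
  shows "lnorm (\<lambda>x. u x + v x) \<le> lnorm u + lnorm v"
proof (rule ennreal_le_epsilon)
  fix e :: real assume fin: "lnorm u + lnorm v < top" and e: "e > 0"
  obtain A where A: "A \<ge> 0" "lnorm u = ennreal A" using fin by (cases "lnorm u") auto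
  obtain B where B: "B \<ge> 0" "lnorm v = ennreal B" using fin by (cases "lnorm v") auto
  define l where "l = A + e / 2"
  define m where "m = B + e / 2"
  have "lnorm u < ennreal l" "lnorm v < ennreal m"
    using A B e by (auto simp: l_def m_def ennreal_less_iff)
  note l = lux_lessD[OF this(1)] and m = lux_lessD[OF this(2)]
  \<comment> \<open>With this weight, \<open>(u + v) / (l + m)\<close> is the convex combination of
    \<open>u / l\<close> and \<open>v / m\<close>, both of energy at most \<open>1\<close>.\<close>
  define s where "s = m / (l + m)"
  have s: "0 \<le> s" "s \<le> 1" "1 - s = l / (l + m)" using l(1) m(1) by (auto simp: s_def field_simps)
  have "(\<lambda>x. (u x + v x) / complex_of_real (l + m))
    = (\<lambda>x. complex_of_real (1 - s) * (u x / complex_of_real l) + complex_of_real s * (v x / complex_of_real m))"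
    unfolding s(3) unfolding s_def using l(1) m(1) by (simp add: add_divide_distrib)
  then have "F (\<lambda>x. (u x + v x) / complex_of_real (l + m))
    \<le> ennreal (1 - s) * F (\<lambda>x. u x / complex_of_real l) + ennreal s * F (\<lambda>x. v x / complex_of_real m)"
    using Fint_convex_comb[OF L1loc_divide[OF u] L1loc_divide[OF v] s(1,2), of l m] by simp
  also have "\<dots> \<le> ennreal (1 - s) * 1 + ennreal s * 1"
    using l m by (intro add_mono mult_left_mono) auto
  also have "\<dots> = 1"
    using s by (simp flip: ennreal_plus)
  finally have "lnorm (\<lambda>x. u x + v x) \<le> ennreal (l + m)"
    using l(1) m(1) by (intro lux_leI) auto
  also have "\<dots> = lnorm u + lnorm v + ennreal e"
    using A B e by (simp add: l_def m_def flip: ennreal_plus)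
  finally show "lnorm (\<lambda>x. u x + v x) \<le> lnorm u + lnorm v + ennreal e" .
qed

text \<open>Continuity of the integrand makes the energy densities converge a.e., and Fatou's lemma
  does the rest. The strict bound makes \<open>e\<close> an admissible level for every
  \<open>Y n\<close>.\<close>

lemma lux_le_of_AE_tendsto:
  assumes Y: "\<And>n. L1loc \<Omega> (Y n)" and lim: "AE x in lebesgue. x \<in> \<Omega> \<longrightarrow> (\<lambda>n. Y n x) \<longlonglongrightarrow> Z x"
    and le: "\<And>n. lnorm (Y n) < ennreal e"
  shows "lnorm Z \<le> ennreal e"
proof (rule lux_leI)
  show e: "e > 0" using lux_lessD(1)[OF le] .
  let ?Y = "\<lambda>n x. Y n x / complex_of_real e" and ?Z = "\<lambda>x. Z x / complex_of_real e"
  have "F ?Z \<le> (\<integral>\<^sup>+ z. liminf (\<lambda>n. dens (?Y n) z) \<partial>lebesgue)"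
    unfolding Fint_eq_dens
  proof (rule nn_integral_mono_AE)
    show "AE z in lebesgue. dens ?Z z \<le> liminf (\<lambda>n. dens (?Y n) z)"
      using \<phi>_convex_ae AE_lebesgue_fst[OF lim] AE_lebesgue_snd[OF lim]
    proof eventually_elim
      case (elim z)
      have "(\<lambda>n. dens (?Y n) z) \<longlonglongrightarrow> dens ?Z z"
      proof (cases "z \<in> \<Omega> \<times> \<Omega>")
        case True
        have "(\<lambda>n. cmod (?Y n (fst z) - ?Y n (snd z))) \<longlonglongrightarrow> cmod (?Z (fst z) - ?Z (snd z))"
          using elim True e by (intro tendsto_intros) auto
        then have "(\<lambda>n. \<phi> (cmod (?Y n (fst z) - ?Y n (snd z))) (fst z) (snd z)) \<longlonglongrightarrow>
            \<phi> (cmod (?Z (fst z) - ?Z (snd z))) (fst z) (snd z)"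
          using elim True by (intro continuous_on_tendsto_compose[of "{0..}" "\<lambda>t. \<phi> t (fst z) (snd z)"]) auto
        then have "(\<lambda>n. ennreal (\<phi> (cmod (?Y n (fst z) - ?Y n (snd z))) (fst z) (snd z) * a (fst z - snd z))) \<longlonglongrightarrow>
            ennreal (\<phi> (cmod (?Z (fst z) - ?Z (snd z))) (fst z) (snd z) * a (fst z - snd z))"
          by (intro tendsto_ennrealI tendsto_mult tendsto_const)
        then show ?thesis using True by (simp add: dens_def)
      qed (simp add: dens_def)
      then show ?case
        by (simp add: lim_imp_Liminf)
    qed
  qed
  also have "\<dots> \<le> liminf (\<lambda>n. F (?Y n))"
    unfolding Fint_eq_dens by (intro nn_integral_liminf dens_measurable L1loc_divide Y)
  also have "\<dots> \<le> liminf (\<lambda>n::nat. 1)"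
    using lux_lessD(2)[OF le] by (intro Liminf_mono) auto
  also have "\<dots> = 1"
    by (simp add: Liminf_const)
  finally show "F ?Z \<le> 1" .
qed

end

section \<open>The mean-free part\<close>

context nonlocal_energy
begin

abbreviation "vol \<equiv> measure lebesgue \<Omega>"

lemma vol_pos: "vol > 0"
  using measure_open_bounded_pos[OF open_dom bounded_dom dom_ne] open_dom by simp

lemma emeasure_dom: "emeasure lborel \<Omega> = ennreal vol"
  using emeasure_bounded_finite[OF bounded_dom] open_dom
  by (subst emeasure_eq_ennreal_measure) auto

text \<open>For pairs closer than \<open>r\<close>, coercivity and \<open>a \<ge> c0\<close> give
  \<open>|u(x) - u(y)|^p \<le> 1 + k / c0 * \<phi> * a\<close>. Integrating the two summands yields
  \<open>vol * vol\<close> and \<open>k / c0\<close>. The Borel version \<open>w\<close> of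
  \<open>u\<close> gives access to iterated integrals.\<close>

lemma near_interaction_le:
  assumes u: "L1loc \<Omega> u" and F: "F u \<le> 1"
    and [measurable]: "w \<in> borel_measurable borel" and w: "AE x in lebesgue. x \<in> \<Omega> \<longrightarrow> u x = w x"
  shows "dint_near r (\<lambda>z. ennreal (cmod (w (fst z) - w (snd z)) powr p)) \<Omega> \<le> ennreal (vol * vol + k / c0)"
proof -
  have [measurable]: "\<Omega> \<in> sets borel" using open_dom by simp
  let ?g = "\<lambda>z. indicator \<Omega> (fst z) * (indicator (\<Omega> \<inter> ball (fst z) r) (snd z) *
     ennreal (cmod (w (fst z) - w (snd z)) powr p))"
  \<comment> \<open>Rewriting the moving ball through the distance makes joint measurability in the
    pair visible.\<close>
  have ball_eq: "indicator (\<Omega> \<inter> ball (fst z) r) (snd z) = (indicator \<Omega> (snd z) * indicator {..<r} (dist (fst z) (snd z)) :: ennreal)"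
    for z :: "'a \<times> 'a"
    by (simp split: split_indicator)
  have "?g \<in> borel_measurable (lborel \<Otimes>\<^sub>M lborel)"
    unfolding ball_eq by measurable
  then have "dint_near r (\<lambda>z. ennreal (cmod (w (fst z) - w (snd z)) powr p)) \<Omega> = (\<integral>\<^sup>+ z. ?g z \<partial>(lborel \<Otimes>\<^sub>M lborel))"
    unfolding dint_near_def by (subst lborel.nn_integral_fst[symmetric]) auto
  also have "\<dots> = (\<integral>\<^sup>+ z. ?g z \<partial>lebesgue)"
    by (simp add: lborel_prod nn_integral_completion)
  also have "\<dots> \<le> (\<integral>\<^sup>+ z. indicator (\<Omega> \<times> \<Omega>) z + ennreal (k / c0) * dens u z \<partial>lebesgue)"
  proof (rule nn_integral_mono_AE)
    show "AE z in lebesgue. ?g z \<le> indicator (\<Omega> \<times> \<Omega>) z + ennreal (k / c0) * dens u z"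
      using coercive_ae AE_lebesgue_diff[OF a_ge] AE_lebesgue_fst[OF w] AE_lebesgue_snd[OF w]
    proof eventually_elim
      case (elim z)
      show ?case
      proof (cases "z \<in> \<Omega> \<times> \<Omega> \<and> dist (fst z) (snd z) < r")
        case True
        then have "fst z - snd z \<in> ball 0 r"
          by (simp add: dist_norm norm_minus_commute)
        then have a: "a (fst z - snd z) \<ge> c0" using elim by simp
        let ?t = "cmod (u (fst z) - u (snd z))"
        let ?f = "\<phi> ?t (fst z) (snd z)"
        have f: "?f \<ge> 0" using True by (intro \<phi>_nonneg) (auto simp: mem_Times_iff)
        have "?t powr p \<le> 1 + k * ?f" using elim True by simp
        also have "k * ?f = k / c0 * (?f * c0)" using c0_pos by simp
        also have "\<dots> \<le> k / c0 * (?f * a (fst z - snd z))"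
          using a f c0_pos k_nonneg by (intro mult_left_mono) auto
        finally have "ennreal (?t powr p) \<le> ennreal (1 + k / c0 * (?f * a (fst z - snd z)))"
          by (intro ennreal_leI) simp
        also have "\<dots> = 1 + ennreal (k / c0) * ennreal (?f * a (fst z - snd z))"
        proof -
          have "ennreal (1 + k / c0 * h) = 1 + ennreal (k / c0) * ennreal h" if "h \<ge> 0" for h
            using that c0_pos k_nonneg ennreal_mult[of "k / c0" h] by simp
          then show ?thesis
            using f a_nonneg by (simp only: zero_le_mult_iff simp_thms)
        qed
        finally show ?thesis
          using True elim by (auto simp: dens_def mem_Times_iff)
      qed (auto simp: mem_Times_iff split: split_indicator)
    qed
  qed
  also have "\<dots> = emeasure lebesgue (\<Omega> \<times> \<Omega>) + ennreal (k / c0) * F u"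
  proof -
    have "\<Omega> \<times> \<Omega> \<in> sets lebesgue"
      using open_dom by (intro sets_completionI_sets) (auto intro!: borel_open open_Times)
    then show ?thesis
      unfolding Fint_eq_dens using dens_measurable[OF u]
      by (simp add: nn_integral_add nn_integral_cmult)
  qed
  also have "emeasure lebesgue (\<Omega> \<times> \<Omega>) = emeasure (lborel \<Otimes>\<^sub>M lborel) (\<Omega> \<times> \<Omega>)"
    unfolding lborel_prod using open_dom by (simp add: borel_open open_Times)
  also have "\<dots> = ennreal (vol * vol)"
    by (simp add: lborel.emeasure_pair_measure_Times emeasure_dom ennreal_mult)
  also have "ennreal (vol * vol) + ennreal (k / c0) * F u \<le> ennreal (vol * vol) + ennreal (k / c0) * 1"
    by (intro add_left_mono mult_left_mono F) auto
  also have "\<dots> = ennreal (vol * vol + k / c0)"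
    using k_nonneg c0_pos by (simp flip: ennreal_plus)
  finally show ?thesis .
qed

text \<open>The double integral bounds the average over \<open>x\<close> of the inner integral
  \<open>G x\<close>, so some point \<open>x0\<close> does no worse than \<open>Q\<close>; the
  constant \<open>w x0\<close> is then subtracted.\<close>

lemma ex_Lp_bound_mod_const:
  "\<exists>Q\<ge>0. \<forall>u. L1loc \<Omega> u \<longrightarrow> F u \<le> 1 \<longrightarrow>
     (\<exists>c. (\<integral>\<^sup>+ x\<in>\<Omega>. ennreal (cmod (u x - c) powr p) \<partial>lebesgue) \<le> ennreal Q)"
proof -
  obtain C where C: "C \<ge> 0"
    "\<And>K. quasi_metric_kernel (2 powr p) K \<Longrightarrow> dint K \<Omega> \<Omega> \<le> ennreal C * dint_near r K \<Omega>"
    using dint_le_dint_near[OF open_dom connected_dom bounded_dom r_pos, of "2 powr p"] by auto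
  \<comment> \<open>The extra \<open>+ 1\<close> makes \<open>Q * vol\<close> strictly larger than
    the bound on the double integral, which yields the contradiction below.\<close>
  define Q where "Q = (C * (vol * vol + k / c0) + 1) / vol"
  have Q0: "C * (vol * vol + k / c0) \<ge> 0"
    using C(1) k_nonneg c0_pos by simp
  then have "Q \<ge> 0"
    using vol_pos by (simp add: Q_def)
  moreover have "\<exists>c. (\<integral>\<^sup>+ x\<in>\<Omega>. ennreal (cmod (u x - c) powr p) \<partial>lebesgue) \<le> ennreal Q"
    if u: "L1loc \<Omega> u" and F: "F u \<le> 1" for u
  proof -
    have [measurable]: "\<Omega> \<in> sets borel" using open_dom by simp
    have "(\<lambda>x. indicator \<Omega> x *\<^sub>R u x) \<in> borel_measurable lebesgue"
      using L1loc_set_borel_measurable[OF open_dom u] by (simp add: set_borel_measurable_def)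
    then obtain w where w[measurable]: "w \<in> borel_measurable borel"
      and uw: "AE x in lebesgue. indicator \<Omega> x *\<^sub>R u x = w x"
      using lebesgue_complex_ex_borel by blast
    have uw: "AE x in lebesgue. x \<in> \<Omega> \<longrightarrow> u x = w x"
      using uw by eventually_elim auto
    let ?K = "\<lambda>z. ennreal (cmod (w (fst z) - w (snd z)) powr p)"
    have K: "quasi_metric_kernel (2 powr p) ?K"
      using p_gt_1 by (intro quasi_metric_kernel_powr w) auto
    have "dint ?K \<Omega> \<Omega> \<le> ennreal C * ennreal (vol * vol + k / c0)"
      using near_interaction_le[OF u F w uw] C(2)[OF K]
      by (meson mult_left_mono order_trans zero_le)
    then have D: "dint ?K \<Omega> \<Omega> \<le> ennreal (C * (vol * vol + k / c0))"
      using C(1) by (simp add: ennreal_mult')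
    define G where "G x = (\<integral>\<^sup>+ y. indicator \<Omega> y * ennreal (cmod (w x - w y) powr p) \<partial>lborel)" for x
    have "\<exists>x\<in>\<Omega>. G x \<le> ennreal Q"
    proof (rule ccontr)
      assume "\<not> ?thesis"
      then have "ennreal Q \<le> G x" if "x \<in> \<Omega>" for x
        using that by force
      then have "(\<integral>\<^sup>+ x. ennreal Q * indicator \<Omega> x \<partial>lborel) \<le> (\<integral>\<^sup>+ x. indicator \<Omega> x * G x \<partial>lborel)"
        by (intro nn_integral_mono) (simp split: split_indicator)
      also have "\<dots> = dint ?K \<Omega> \<Omega>"
        unfolding dint_def G_def by (intro nn_integral_cong, subst nn_integral_cmult[symmetric]) auto
      also have "\<dots> \<le> ennreal (C * (vol * vol + k / c0))" by (rule D)
      also have "(\<integral>\<^sup>+ x. ennreal Q * indicator \<Omega> x \<partial>lborel) = ennreal (C * (vol * vol + k / c0) + 1)"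
        using \<open>Q \<ge> 0\<close> vol_pos by (simp add: nn_integral_cmult_indicator emeasure_dom ennreal_mult[symmetric]) (simp add: Q_def)
      finally show False
        using Q0 by (simp add: ennreal_le_iff del: ennreal_plus)
    qed
    then obtain x0 where x0: "x0 \<in> \<Omega>" "G x0 \<le> ennreal Q" by blast
    have "(\<integral>\<^sup>+ x\<in>\<Omega>. ennreal (cmod (u x - w x0) powr p) \<partial>lebesgue)
        = (\<integral>\<^sup>+ y. indicator \<Omega> y * ennreal (cmod (w x0 - w y) powr p) \<partial>lebesgue)"
    proof (rule nn_integral_cong_AE)
      show "AE x in lebesgue. ennreal (cmod (u x - w x0) powr p) * indicator \<Omega> x
          = indicator \<Omega> x * ennreal (cmod (w x0 - w x) powr p)"
        using uw by eventually_elim (simp add: norm_minus_commute split: split_indicator)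
    qed
    also have "\<dots> = G x0"
      unfolding G_def by (rule nn_integral_completion)
    finally show ?thesis using x0(2) by metis
  qed
  ultimately show ?thesis by blast
qed

section \<open>Integrals and mean values over the domain, and the Poincare bound for the mean-free
  part\<close>

abbreviation "\<mu> \<equiv> lebesgue_on \<Omega>"

lemma dom_sets: "\<Omega> \<in> sets lebesgue"
  using open_dom by simp

lemma finite_measure_dom: "finite_measure \<mu>"
  using dom_sets emeasure_dom emeasure_completion[of \<Omega> lborel] open_dom
  by (intro finite_measureI) (auto simp: space_restrict_space emeasure_restrict_space)

lemma measure_dom: "measure \<mu> \<Omega> = vol"
  using dom_sets by (simp add: measure_restrict_space)

lemma set_integrable_dom: "set_integrable lebesgue \<Omega> f \<longleftrightarrow> integrable \<mu> f"
  for f :: "'a \<Rightarrow> 'b::{banach, second_countable_topology}"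
  unfolding set_integrable_def using dom_sets by (simp add: integrable_restrict_space)

lemma set_integral_dom: "(LINT x:\<Omega>|lebesgue. f x) = (\<integral>x. f x \<partial>\<mu>)"
  for f :: "'a \<Rightarrow> 'b::{banach, second_countable_topology}"
  unfolding set_lebesgue_integral_def using dom_sets by (simp add: integral_restrict_space)

lemma set_borel_measurable_dom: "set_borel_measurable lebesgue \<Omega> f \<longleftrightarrow> f \<in> borel_measurable \<mu>"
  for f :: "'a \<Rightarrow> complex"
  unfolding set_borel_measurable_def using dom_sets by (simp add: borel_measurable_restrict_space_iff)

lemma Lp_on_dom: "Lp_on \<Omega> q f \<longleftrightarrow> f \<in> borel_measurable \<mu> \<and> integrable \<mu> (\<lambda>x. cmod (f x) powr q)"
  by (simp add: Lp_on_def set_integrable_dom set_borel_measurable_dom)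

lemma integrable_const_dom: "integrable \<mu> (\<lambda>x. c)"
  for c :: "'b::{banach, second_countable_topology}"
  using finite_measure.integrable_const[OF finite_measure_dom] .

lemma mean_val_dom: "mean_val \<Omega> f = (\<integral>x. f x \<partial>\<mu>) / complex_of_real vol"
  by (simp add: mean_val_def set_integral_dom)

lemma mean_val_add_const:
  assumes "integrable \<mu> f"
  shows "mean_val \<Omega> (\<lambda>x. f x + c) = mean_val \<Omega> f + c"
  using vol_pos assms
  by (simp add: mean_val_dom integrable_const_dom measure_dom add_divide_distrib scaleR_conv_of_real)

text \<open>The estimate is not homogeneous in \<open>f\<close>; applied later to functions divided
  by a suitable level, it yields homogeneous bounds.\<close>

lemma Lp_integrable:
  assumes "f \<in> borel_measurable \<mu>" "integrable \<mu> (\<lambda>x. cmod (f x) powr p)"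
  shows "integrable \<mu> f" and "(\<integral>x. cmod (f x) \<partial>\<mu>) \<le> vol + (\<integral>x. cmod (f x) powr p \<partial>\<mu>)"
proof -
  have le: "cmod (f x) \<le> 1 + cmod (f x) powr p" for x
    using p_gt_1 by (intro le_one_plus_powr) auto
  have i: "integrable \<mu> (\<lambda>x. 1 + cmod (f x) powr p)"
    by (intro Bochner_Integration.integrable_add integrable_const_dom assms)
  show f: "integrable \<mu> f"
    by (rule Bochner_Integration.integrable_bound[OF i assms(1)]) (use le in auto)
  have "(\<integral>x. cmod (f x) \<partial>\<mu>) \<le> (\<integral>x. 1 + cmod (f x) powr p \<partial>\<mu>)"
    by (intro integral_mono i integrable_norm f le)
  also have "\<dots> = vol + (\<integral>x. cmod (f x) powr p \<partial>\<mu>)"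
    using assms(2) by (simp add: integrable_const_dom measure_dom)
  finally show "(\<integral>x. cmod (f x) \<partial>\<mu>) \<le> vol + (\<integral>x. cmod (f x) powr p \<partial>\<mu>)" .
qed

lemma Lp_add_const:
  assumes "f \<in> borel_measurable \<mu>" "integrable \<mu> (\<lambda>x. cmod (f x) powr p)"
  shows "integrable \<mu> (\<lambda>x. cmod (f x + c) powr p)"
    and "(\<integral>x. cmod (f x + c) powr p \<partial>\<mu>) \<le> 2 powr p * ((\<integral>x. cmod (f x) powr p \<partial>\<mu>) + cmod c powr p * vol)"
proof -
  have le: "cmod (f x + c) powr p \<le> 2 powr p * (cmod (f x) powr p + cmod c powr p)" for x
    using p_gt_1 by (intro cmod_add_powr_le) auto
  have i: "integrable \<mu> (\<lambda>x. 2 powr p * (cmod (f x) powr p + cmod c powr p))"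
    by (intro integrable_mult_right Bochner_Integration.integrable_add integrable_const_dom assms)
  show f: "integrable \<mu> (\<lambda>x. cmod (f x + c) powr p)"
    by (rule Bochner_Integration.integrable_bound[OF i]) (use le assms(1) in auto)
  have "(\<integral>x. cmod (f x + c) powr p \<partial>\<mu>) \<le> (\<integral>x. 2 powr p * (cmod (f x) powr p + cmod c powr p) \<partial>\<mu>)"
    by (intro integral_mono i f le)
  also have "\<dots> = 2 powr p * ((\<integral>x. cmod (f x) powr p \<partial>\<mu>) + cmod c powr p * vol)"
    using assms(2) by (simp add: integrable_const_dom measure_dom mult_ac)
  finally show "(\<integral>x. cmod (f x + c) powr p \<partial>\<mu>) \<le> 2 powr p * ((\<integral>x. cmod (f x) powr p \<partial>\<mu>) + cmod c powr p * vol)" .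
qed

text \<open>For a non-integrable \<open>f\<close> the integral on the left is \<open>0\<close> by
  default, and the right side is nonnegative.\<close>

lemma cmod_mean_le:
  shows "cmod (mean_val \<Omega> f) \<le> (\<integral>x. cmod (f x) \<partial>\<mu>) / vol"
  using vol_pos integral_norm_bound[of \<mu> f]
  by (simp add: mean_val_dom norm_divide divide_right_mono)

text \<open>Passes from some constant \<open>c\<close> to the mean value: the mean of
  \<open>f = u - c\<close> is controlled by the \<open>L_p\<close> bound on \<open>f\<close>, so
  removing it costs only a further constant.\<close>

lemma ex_poincare_unit:
  "\<exists>K\<ge>0. \<forall>u. L1loc \<Omega> u \<longrightarrow> F u \<le> 1 \<longrightarrow> u \<in> borel_measurable \<mu> \<and>
     integrable \<mu> (\<lambda>x. cmod (u x) powr p) \<and> (\<integral>x. cmod (u x - mean_val \<Omega> u) powr p \<partial>\<mu>) \<le> K"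
proof -
  obtain Q where Q: "Q \<ge> 0" "\<And>u. L1loc \<Omega> u \<Longrightarrow> F u \<le> 1 \<Longrightarrow>
     (\<exists>c. (\<integral>\<^sup>+ x\<in>\<Omega>. ennreal (cmod (u x - c) powr p) \<partial>lebesgue) \<le> ennreal Q)"
    using ex_Lp_bound_mod_const by blast
  \<comment> \<open>Here \<open>(vol + Q) / vol\<close> bounds the modulus of the mean of
    \<open>f\<close>, and \<open>2 powr p\<close> is the price of shifting by that mean.\<close>
  define K where "K = 2 powr p * (Q + ((vol + Q) / vol) powr p * vol)"
  have "K \<ge> 0" using Q(1) vol_pos by (simp add: K_def)
  moreover have "u \<in> borel_measurable \<mu> \<and>
     integrable \<mu> (\<lambda>x. cmod (u x) powr p) \<and> (\<integral>x. cmod (u x - mean_val \<Omega> u) powr p \<partial>\<mu>) \<le> K"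
    if u: "L1loc \<Omega> u" and F: "F u \<le> 1" for u
  proof -
    have um[measurable]: "u \<in> borel_measurable \<mu>"
      using L1loc_set_borel_measurable[OF open_dom u] by (simp add: set_borel_measurable_dom)
    obtain c where "(\<integral>\<^sup>+ x\<in>\<Omega>. ennreal (cmod (u x - c) powr p) \<partial>lebesgue) \<le> ennreal Q"
      using Q(2)[OF u F] by blast
    then have c: "(\<integral>\<^sup>+ x. ennreal (cmod (u x - c) powr p) \<partial>\<mu>) \<le> ennreal Q"
      using dom_sets by (simp add: nn_integral_restrict_space)
    define f where "f = (\<lambda>x. u x - c)"
    have fm: "f \<in> borel_measurable \<mu>" unfolding f_def by measurable
    have fi: "integrable \<mu> (\<lambda>x. cmod (f x) powr p)"
      using c fm unfolding f_def by (intro integrableI_bounded) (auto intro: le_less_trans)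
    have fQ: "(\<integral>x. cmod (f x) powr p \<partial>\<mu>) \<le> Q"
      using c fi Q(1) by (intro integral_real_bounded) (auto simp: f_def)
    have uf: "u = (\<lambda>x. f x + c)" by (simp add: f_def)
    have mean: "mean_val \<Omega> u = mean_val \<Omega> f + c"
      unfolding uf using Lp_integrable(1)[OF fm fi] by (rule mean_val_add_const)
    have "cmod (mean_val \<Omega> f) \<le> (vol + Q) / vol"
      using cmod_mean_le[of f] Lp_integrable(2)[OF fm fi] fQ vol_pos
      by (meson add_left_mono divide_right_mono less_imp_le order_trans)
    then have mf: "cmod (- mean_val \<Omega> f) powr p \<le> ((vol + Q) / vol) powr p"
      using p_gt_1 by (intro powr_mono2) auto
    have "(\<integral>x. cmod (u x - mean_val \<Omega> u) powr p \<partial>\<mu>) = (\<integral>x. cmod (f x + (- mean_val \<Omega> f)) powr p \<partial>\<mu>)"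
      by (simp add: mean f_def algebra_simps)
    also have "\<dots> \<le> 2 powr p * ((\<integral>x. cmod (f x) powr p \<partial>\<mu>) + cmod (- mean_val \<Omega> f) powr p * vol)"
      by (rule Lp_add_const(2)[OF fm fi])
    also have "\<dots> \<le> K"
      unfolding K_def using fQ mf vol_pos by (intro mult_left_mono add_mono mult_right_mono) auto
    finally show ?thesis
      using um Lp_add_const(1)[OF fm fi, of c] by (simp add: uf)
  qed
  ultimately show ?thesis by blast
qed

text \<open>Choice fixes one bound valid for all \<open>u\<close>, so that later estimates can name
  it.\<close>

definition poincare_const :: real where
  "poincare_const = (SOME K. K \<ge> 0 \<and> (\<forall>u. L1loc \<Omega> u \<longrightarrow> F u \<le> 1 \<longrightarrow> u \<in> borel_measurable \<mu> \<and>
     integrable \<mu> (\<lambda>x. cmod (u x) powr p) \<and> (\<integral>x. cmod (u x - mean_val \<Omega> u) powr p \<partial>\<mu>) \<le> K))"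

lemma poincare_unit:
  shows "poincare_const \<ge> 0"
    and "L1loc \<Omega> u \<Longrightarrow> F u \<le> 1 \<Longrightarrow> u \<in> borel_measurable \<mu>"
    and "L1loc \<Omega> u \<Longrightarrow> F u \<le> 1 \<Longrightarrow> integrable \<mu> (\<lambda>x. cmod (u x) powr p)"
    and "L1loc \<Omega> u \<Longrightarrow> F u \<le> 1 \<Longrightarrow> (\<integral>x. cmod (u x - mean_val \<Omega> u) powr p \<partial>\<mu>) \<le> poincare_const"
  using someI_ex[OF ex_poincare_unit] unfolding poincare_const_def by blast+

lemma mean_val_divide: "mean_val \<Omega> (\<lambda>x. f x / c) = mean_val \<Omega> f / c"
  by (simp add: mean_val_dom)

text \<open>The unit estimate is applied to \<open>u / l\<close>, whose energy is at most
  \<open>1\<close>. The \<open>p\<close>-th power integral scales with \<open>l powr p\<close> and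
  the \<open>L_1\<close> integral with \<open>l\<close>.\<close>

lemma poincare_scaled:
  assumes u: "L1loc \<Omega> u" and l: "lnorm u < ennreal l"
  shows "u \<in> borel_measurable \<mu>" and "integrable \<mu> (\<lambda>x. cmod (u x) powr p)"
    and "(\<integral>x. cmod (u x - mean_val \<Omega> u) powr p \<partial>\<mu>) \<le> poincare_const * l powr p"
    and "(\<integral>x. cmod (u x - mean_val \<Omega> u) \<partial>\<mu>) \<le> (vol + poincare_const) * l"
proof -
  note l = lux_lessD[OF l]
  let ?v = "\<lambda>x. u x / complex_of_real l"
  have v: "L1loc \<Omega> ?v" by (rule L1loc_divide[OF u])
  note P = poincare_unit(2-4)[OF v l(2)]
  have "(\<lambda>x. complex_of_real l * ?v x) \<in> borel_measurable \<mu>"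
    using P(1) by (intro borel_measurable_times borel_measurable_const)
  then show um: "u \<in> borel_measurable \<mu>" using l(1) by simp
  have scale: "cmod (y / complex_of_real l) powr p = cmod y powr p / l powr p" for y
    using l(1) by (simp add: norm_divide powr_divide)
  have "integrable \<mu> (\<lambda>x. l powr p * (cmod (?v x) powr p))"
    using P(2) by (rule integrable_mult_right)
  then show ui: "integrable \<mu> (\<lambda>x. cmod (u x) powr p)"
    using l(1) by (simp add: scale)
  have diff: "?v x - mean_val \<Omega> ?v = (u x - mean_val \<Omega> u) / complex_of_real l" for x
    by (simp add: mean_val_divide diff_divide_distrib)
  show "(\<integral>x. cmod (u x - mean_val \<Omega> u) powr p \<partial>\<mu>) \<le> poincare_const * l powr p"
    using P(3) l(1) unfolding diff scale by (simp add: field_simps)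
  have vm: "(\<lambda>x. ?v x + (- mean_val \<Omega> ?v)) \<in> borel_measurable \<mu>"
    using P(1) by (intro borel_measurable_add borel_measurable_const)
  have "(\<integral>x. cmod (?v x - mean_val \<Omega> ?v) \<partial>\<mu>) \<le> vol + poincare_const"
    using Lp_integrable(2)[OF vm Lp_add_const(1)[OF P(1,2)]] P(3) by simp
  then show "(\<integral>x. cmod (u x - mean_val \<Omega> u) \<partial>\<mu>) \<le> (vol + poincare_const) * l"
    using l(1) unfolding diff by (simp add: norm_divide field_simps)
qed

end

section \<open>Completeness and norm equivalence\<close>

context nonlocal_energy
begin

abbreviation "Lnorm \<equiv> Lp_norm \<Omega> p"

section \<open>Integrability of representatives and bounds for means and mean-free parts\<close>

lemma integrable_imp_L1loc:
  assumes "integrable \<mu> u"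
  shows "L1loc \<Omega> u"
  unfolding L1loc_def
proof (intro allI impI)
  fix K assume K: "compact K \<and> K \<subseteq> \<Omega>"
  then have "K \<in> sets lebesgue" by (simp add: borel_compact)
  then show "set_integrable lebesgue K u"
    using assms K set_integrable_subset[of lebesgue \<Omega> u K]
    by (simp add: set_integrable_dom)
qed

lemma Lp_on_imp_Lploc:
  assumes "Lp_on \<Omega> p u"
  shows "Lploc \<Omega> p u"
  unfolding Lploc_def
proof (intro allI impI conjI)
  fix K assume K: "compact K \<and> K \<subseteq> \<Omega>"
  then have [measurable]: "K \<in> sets lebesgue" by (simp add: borel_compact)
  show "set_integrable lebesgue K (\<lambda>x. cmod (u x) powr p)"
    using assms K by (auto simp: Lp_on_def intro: set_integrable_subset)
  have g: "(\<lambda>x. indicator \<Omega> x *\<^sub>R u x) \<in> borel_measurable lebesgue"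
    using assms by (simp add: Lp_on_def set_borel_measurable_def)
  have "(\<lambda>x. indicator K x *\<^sub>R (indicator \<Omega> x *\<^sub>R u x)) \<in> borel_measurable lebesgue"
    by (rule borel_measurable_scaleR[OF _ g]) simp
  moreover have "indicator K x *\<^sub>R (indicator \<Omega> x *\<^sub>R u x) = indicator K x *\<^sub>R u x" for x
    using K by (auto split: split_indicator)
  ultimately show "set_borel_measurable lebesgue K u"
    by (simp only: set_borel_measurable_def)
qed

lemma Lp_on_imp_integrable: "Lp_on \<Omega> p u \<Longrightarrow> integrable \<mu> u"
  by (rule Lp_integrable(1)) (simp_all add: Lp_on_dom)

lemma Lp_on_add_const:
  assumes "Lp_on \<Omega> p u"
  shows "Lp_on \<Omega> p (\<lambda>x. u x + c)"
proof -
  have u: "u \<in> borel_measurable \<mu>" "integrable \<mu> (\<lambda>x. cmod (u x) powr p)"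
    using assms by (simp_all add: Lp_on_dom)
  then show ?thesis
    unfolding Lp_on_dom by (intro conjI borel_measurable_add borel_measurable_const Lp_add_const(1))
qed

lemma Lp_norm_eq: "Lp_on \<Omega> p u \<Longrightarrow> Lnorm u = ennreal ((\<integral>x. cmod (u x) powr p \<partial>\<mu>) powr (1 / p))"
  by (simp add: Lp_norm_def set_integral_dom)

text \<open>A finite seminorm leaves room for a real level above it, here \<open>A + 1\<close>, and
  the scaled Poincare estimate then gives \<open>L_p\<close> membership of every
  representative.\<close>

lemma Lambda_rep_Lp_on:
  assumes "Lambda_rep \<phi> a \<Omega> u"
  shows "Lp_on \<Omega> p u"
proof -
  have u: "L1loc \<Omega> u" "lnorm u < top" using assms by (auto simp: Lambda_rep_def)
  obtain A where "A \<ge> 0" "lnorm u = ennreal A" using u(2) by (cases "lnorm u") auto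
  then have "lnorm u < ennreal (A + 1)" by (simp add: ennreal_less_iff del: ennreal_plus)
  from poincare_scaled(1,2)[OF u(1) this] show ?thesis by (simp add: Lp_on_dom)
qed

lemma Lambda_rep_integrable: "Lambda_rep \<phi> a \<Omega> u \<Longrightarrow> integrable \<mu> u"
  by (intro Lp_on_imp_integrable Lambda_rep_Lp_on)

lemma L1_perp_le:
  assumes "Lambda_rep \<phi> a \<Omega> u"
  shows "ennreal (\<integral>x. cmod (u x - mean_val \<Omega> u) \<partial>\<mu>) \<le> ennreal (vol + poincare_const) * lnorm u"
  using assms vol_pos poincare_unit(1) poincare_scaled(4)
  by (intro ennreal_le_cmultI ennreal_leI) (auto simp: Lambda_rep_def)

text \<open>The \<open>p\<close>-th root of the scaled Poincare inequality, with \<open>l\<close>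
  decreasing to the Luxemburg norm.\<close>

lemma Lp_norm_perp_le:
  assumes "Lambda_rep \<phi> a \<Omega> u"
  shows "Lnorm (perp_part \<Omega> u) \<le> ennreal (poincare_const powr (1 / p)) * lnorm u"
proof (rule ennreal_le_cmultI)
  have u: "L1loc \<Omega> u" using assms by (simp add: Lambda_rep_def)
  fix l assume l: "lnorm u < ennreal l"
  have "Lp_on \<Omega> p (perp_part \<Omega> u)"
    using Lp_on_add_const[OF Lambda_rep_Lp_on[OF assms], of "- mean_val \<Omega> u"] by (simp add: perp_part_def)
  then have "Lnorm (perp_part \<Omega> u) = ennreal ((\<integral>x. cmod (u x - mean_val \<Omega> u) powr p \<partial>\<mu>) powr (1 / p))"
    by (simp add: Lp_norm_eq perp_part_def)
  also have "\<dots> \<le> ennreal ((poincare_const * l powr p) powr (1 / p))"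
    using p_gt_1 by (intro ennreal_leI powr_mono2 poincare_scaled(3)[OF u l]) auto
  also have "\<dots> = ennreal (poincare_const powr (1 / p) * l)"
    using p_gt_1 poincare_unit(1) lux_lessD(1)[OF l] by (simp add: powr_mult powr_powr)
  finally show "Lnorm (perp_part \<Omega> u) \<le> ennreal (poincare_const powr (1 / p) * l)" .
qed (use assms in \<open>auto simp: Lambda_rep_def\<close>)

text \<open>Dividing by a level \<open>l\<close> above the \<open>L_p\<close> norm brings the
  \<open>p\<close>-th power integral below \<open>1\<close>; \<open>t \<le> 1 + t powr p\<close>
  then gives an \<open>L_1\<close> bound of \<open>vol + 1\<close>, and scaling back makes the
  estimate homogeneous.\<close>

lemma mean_le_Lp_norm:
  assumes "Lp_on \<Omega> p u"
  shows "ennreal (cmod (mean_val \<Omega> u)) \<le> ennreal ((vol + 1) / vol) * Lnorm u"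
proof (rule ennreal_le_cmultI)
  let ?I = "\<integral>x. cmod (u x) powr p \<partial>\<mu>"
  fix l assume "Lnorm u < ennreal l"
  then have l: "?I powr (1 / p) < l"
    using assms by (simp add: Lp_norm_eq ennreal_less_iff)
  then have l0: "l > 0"
    by (rule le_less_trans[rotated]) simp
  have "?I = (?I powr (1 / p)) powr p"
    using p_gt_1 by (simp add: powr_powr)
  also have "\<dots> \<le> l powr p"
    using l p_gt_1 by (intro powr_mono2) auto
  finally have I: "?I \<le> l powr p" .
  let ?v = "\<lambda>x. u x / complex_of_real l"
  have scale: "cmod (y / complex_of_real l) powr p = cmod y powr p / l powr p" for y
    using l0 by (simp add: norm_divide powr_divide)
  have "(\<integral>x. cmod (?v x) \<partial>\<mu>) \<le> vol + (\<integral>x. cmod (?v x) powr p \<partial>\<mu>)"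
    using assms unfolding Lp_on_dom by (intro Lp_integrable(2)) (auto simp: scale)
  also have "\<dots> \<le> vol + 1"
    using I l0 by (simp add: scale)
  finally have "(\<integral>x. cmod (u x) \<partial>\<mu>) / l \<le> vol + 1"
    using l0 by (simp add: norm_divide)
  then have "(\<integral>x. cmod (u x) \<partial>\<mu>) / vol \<le> (vol + 1) * l / vol"
    using l0 vol_pos by (intro divide_right_mono) (auto simp: field_simps)
  then show "ennreal (cmod (mean_val \<Omega> u)) \<le> ennreal ((vol + 1) / vol * l)"
    using cmod_mean_le[of u] by (intro ennreal_leI) simp
qed (use assms vol_pos in \<open>auto simp: Lp_norm_eq\<close>)

text \<open>A substitute for Minkowski's inequality with a larger constant: the sum \<open>S\<close>
  of the two moduli dominates each, so the pointwise quasi-triangle inequality suffices.\<close>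

lemma Lp_norm_add_const_le:
  assumes "Lp_on \<Omega> p u"
  shows "Lnorm (\<lambda>x. u x + c) \<le> ennreal (2 * (1 + vol) powr (1 / p)) * (Lnorm u + ennreal (cmod c))"
proof -
  let ?I = "\<integral>x. cmod (u x) powr p \<partial>\<mu>"
  define S where "S = ?I powr (1 / p) + cmod c"
  have S: "S \<ge> 0" by (simp add: S_def)
  have "?I = (?I powr (1 / p)) powr p"
    using p_gt_1 by (simp add: powr_powr)
  also have "\<dots> \<le> S powr p"
    using p_gt_1 by (intro powr_mono2) (auto simp: S_def)
  finally have I: "?I \<le> S powr p" .
  have c: "cmod c powr p \<le> S powr p"
    using p_gt_1 by (intro powr_mono2) (auto simp: S_def)
  have "(\<integral>x. cmod (u x + c) powr p \<partial>\<mu>) \<le> 2 powr p * (?I + cmod c powr p * vol)"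
    using assms by (intro Lp_add_const(2)) (auto simp: Lp_on_dom)
  also have "\<dots> \<le> 2 powr p * (S powr p + S powr p * vol)"
    using I c vol_pos by (intro mult_left_mono add_mono mult_right_mono) auto
  also have "\<dots> = (2 * S) powr p * (1 + vol)"
    using S by (simp add: powr_mult algebra_simps)
  finally have "(\<integral>x. cmod (u x + c) powr p \<partial>\<mu>) powr (1 / p) \<le> ((2 * S) powr p * (1 + vol)) powr (1 / p)"
    using p_gt_1 by (intro powr_mono2) auto
  also have "\<dots> = 2 * (1 + vol) powr (1 / p) * S"
    using p_gt_1 S vol_pos by (simp add: powr_mult powr_powr)
  finally have "Lnorm (\<lambda>x. u x + c) \<le> ennreal (2 * (1 + vol) powr (1 / p) * S)"
    using Lp_norm_eq[OF Lp_on_add_const[OF assms, of c]] by (simp add: ennreal_leI)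
  also have "\<dots> = ennreal (2 * (1 + vol) powr (1 / p)) * (Lnorm u + ennreal (cmod c))"
    using S vol_pos by (simp add: ennreal_mult Lp_norm_eq[OF assms] S_def)
  finally show ?thesis .
qed

lemma mean_val_perp:
  assumes "integrable \<mu> u"
  shows "mean_val \<Omega> (perp_part \<Omega> u) = 0"
  unfolding perp_part_eq using mean_val_add_const[OF assms, of "- mean_val \<Omega> u"] by simp

text \<open>Two members of one coset differ a.e. by a constant, and that constant is the difference
  of their means.\<close>

lemma coset_eq_mean_unique:
  assumes "integrable \<mu> v" "integrable \<mu> w" "coset_eq \<Omega> v u" "coset_eq \<Omega> w u"
    and mean: "mean_val \<Omega> v = mean_val \<Omega> w"
  shows "AE x in lebesgue. x \<in> \<Omega> \<longrightarrow> w x = v x"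
proof -
  obtain c d where "AE x in lebesgue. x \<in> \<Omega> \<longrightarrow> v x - u x = c" "AE x in lebesgue. x \<in> \<Omega> \<longrightarrow> w x - u x = d"
    using assms(3,4) by (auto simp: coset_eq_def)
  then have wv: "AE x in lebesgue. x \<in> \<Omega> \<longrightarrow> w x = v x + (d - c)"
    by eventually_elim (auto simp: algebra_simps)
  then have "AE x in \<mu>. w x = v x + (d - c)"
    using dom_sets by (simp add: AE_restrict_space_iff)
  then have "(\<integral>x. w x \<partial>\<mu>) = (\<integral>x. v x + (d - c) \<partial>\<mu>)"
    using assms by (intro integral_cong_AE borel_measurable_add) auto
  then have "mean_val \<Omega> w = mean_val \<Omega> v + (d - c)"
    using mean_val_add_const[OF assms(1), of "d - c"] by (simp add: mean_val_dom)
  then have "d - c = 0" using mean by simp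
  with wv show ?thesis by simp
qed

text \<open>The \<open>L_1\<close> Poincare bound makes the integral of \<open>|u - mean|\<close>
  vanish.\<close>

lemma lux_eq_0_imp_const:
  assumes u: "Lambda_rep \<phi> a \<Omega> u" and "lnorm u = 0"
  shows "coset_eq \<Omega> u (\<lambda>x. 0)"
proof -
  have "(\<integral>x. cmod (u x - mean_val \<Omega> u) \<partial>\<mu>) = 0"
    using L1_perp_le[OF u] assms(2) by (intro antisym integral_nonneg_AE) (auto simp: ennreal_eq_0_iff)
  moreover have "integrable \<mu> (\<lambda>x. cmod (u x - mean_val \<Omega> u))"
    by (intro integrable_norm Bochner_Integration.integrable_diff integrable_const_dom Lambda_rep_integrable[OF u])
  ultimately have "AE x in \<mu>. u x = mean_val \<Omega> u"
    by (subst (asm) integral_nonneg_eq_0_iff_AE) auto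
  then have "AE x in lebesgue. x \<in> \<Omega> \<longrightarrow> u x - 0 = mean_val \<Omega> u"
    using dom_sets by (simp add: AE_restrict_space_iff)
  then show ?thesis unfolding coset_eq_def by blast
qed

section \<open>Completeness modulo constants\<close>

lemma L1_perp_diff_less:
  assumes "Lambda_rep \<phi> a \<Omega> u" "Lambda_rep \<phi> a \<Omega> v" and e: "e > 0"
    and less: "lnorm (\<lambda>x. u x - v x) < ennreal (e / (vol + poincare_const + 1))"
  shows "(\<integral>x. cmod (perp_part \<Omega> u x - perp_part \<Omega> v x) \<partial>\<mu>) < e"
proof -
  note ui = Lambda_rep_integrable[OF assms(1)] and vi = Lambda_rep_integrable[OF assms(2)]
  have mean: "mean_val \<Omega> (\<lambda>x. u x - v x) = mean_val \<Omega> u - mean_val \<Omega> v"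
    using ui vi by (simp add: mean_val_dom diff_divide_distrib)
  have "perp_part \<Omega> u x - perp_part \<Omega> v x = u x - v x - mean_val \<Omega> (\<lambda>x. u x - v x)" for x
    unfolding mean by (simp add: perp_part_def)
  then have "(\<integral>x. cmod (perp_part \<Omega> u x - perp_part \<Omega> v x) \<partial>\<mu>)
      = (\<integral>x. cmod (u x - v x - mean_val \<Omega> (\<lambda>x. u x - v x)) \<partial>\<mu>)"
    by simp
  \<comment> \<open>The \<open>+ 1\<close> in the threshold turns this non-strict Poincare bound
    into the strict inequality that the Cauchy criterion requires.\<close>
  also have "\<dots> \<le> (vol + poincare_const) * (e / (vol + poincare_const + 1))"
    using assms(1,2) by (intro poincare_scaled(4) L1loc_diff less) (auto simp: Lambda_rep_def)
  also have "\<dots> < e"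
    using e vol_pos poincare_unit(1) by (simp add: field_simps)
  finally show ?thesis .
qed

lemma lux_minus_commute: "lnorm (\<lambda>x. u x - v x) = lnorm (\<lambda>x. v x - u x)"
proof -
  have "cmod (u x - v x - (u y - v y)) = cmod (v x - u x - (v y - u y))" for x y
    by (subst norm_minus_commute) (simp add: algebra_simps)
  then show ?thesis
    by (intro antisym lux_mono AE_I2) auto
qed

text \<open>The representatives \<open>X n\<close> may drift by arbitrary constants, so convergence
  is sought for their mean-free parts, which the Poincare inequality makes Cauchy in
  \<open>L_1\<close>.\<close>

lemma lux_complete:
  assumes X: "\<And>n. Lambda_rep \<phi> a \<Omega> (X n)"
    and cauchy: "\<And>e. e > 0 \<Longrightarrow> \<exists>N. \<forall>m\<ge>N. \<forall>n\<ge>N. lnorm (\<lambda>x. X m x - X n x) < ennreal e"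
  obtains u where "Lambda_rep \<phi> a \<Omega> u" "(\<lambda>n. lnorm (\<lambda>x. X n x - u x)) \<longlonglongrightarrow> 0"
proof -
  define Y where "Y n = perp_part \<Omega> (X n)" for n
  have Yi: "integrable \<mu> (Y n)" for n
    unfolding Y_def perp_part_eq
    by (intro Bochner_Integration.integrable_add integrable_const_dom Lambda_rep_integrable X)
  have Yc: "\<exists>N. \<forall>i\<ge>N. \<forall>j\<ge>N. (\<integral>x. cmod (Y i x - Y j x) \<partial>\<mu>) < e" if "e > 0" for e
  proof -
    have "e / (vol + poincare_const + 1) > 0"
      using that vol_pos poincare_unit(1) by simp
    then obtain N where "\<And>i j. i \<ge> N \<Longrightarrow> j \<ge> N \<Longrightarrow>
        lnorm (\<lambda>x. X i x - X j x) < ennreal (e / (vol + poincare_const + 1))"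
      using cauchy by blast
    then show ?thesis
      unfolding Y_def by (intro exI[of _ N]) (simp add: L1_perp_diff_less X that)
  qed
  obtain s where s: "strict_mono s" "AE x in \<mu>. Cauchy (\<lambda>i. Y (s i) x)"
    using cauchy_L1_AE_cauchy_subseq[of \<mu> Y, OF Yi Yc] by blast
  define u where "u x = lim (\<lambda>i. Y (s i) x)" for x
  have lim: "AE x in \<mu>. (\<lambda>i. Y (s i) x) \<longlonglongrightarrow> u x"
    using s(2) by eventually_elim (simp add: u_def Cauchy_convergent_iff convergent_LIMSEQ_iff)
  have um: "u \<in> borel_measurable \<mu>"
    unfolding u_def[abs_def] using Yi by (intro borel_measurable_lim_metric) auto
  obtain N where N: "\<And>i j. i \<ge> N \<Longrightarrow> j \<ge> N \<Longrightarrow> (\<integral>x. cmod (Y i x - Y j x) \<partial>\<mu>) < 1"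
    using Yc[of 1] by auto
  \<comment> \<open>Shifting the subsequence by the Cauchy threshold puts every term beyond
    it.\<close>
  have s_ge: "s (i + n) \<ge> n" for i n
    using strict_mono_imp_increasing[OF s(1), of "i + n"] by simp
  have shift: "(\<lambda>i. Y (s (i + n)) x) \<longlonglongrightarrow> u x" if "(\<lambda>i. Y (s i) x) \<longlonglongrightarrow> u x" for x n
    using LIMSEQ_ignore_initial_segment[OF that] .
  \<comment> \<open>The a.e. limit alone carries no integrability; Fatou bounds its
    \<open>L_1\<close> distance to the integrable \<open>Y N\<close> by \<open>1\<close>.\<close>
  have "integrable \<mu> (\<lambda>x. u x - Y N x)"
  proof (rule integrableI_bounded)
    have "(\<integral>\<^sup>+ x. ennreal (cmod (u x - Y N x)) \<partial>\<mu>) \<le> (\<integral>\<^sup>+ x. liminf (\<lambda>i. ennreal (cmod (Y (s (i + N)) x - Y N x))) \<partial>\<mu>)"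
    proof (rule nn_integral_mono_AE)
      show "AE x in \<mu>. ennreal (cmod (u x - Y N x)) \<le> liminf (\<lambda>i. ennreal (cmod (Y (s (i + N)) x - Y N x)))"
        using lim
      proof eventually_elim
        case (elim x)
        have "(\<lambda>i. ennreal (cmod (Y (s (i + N)) x - Y N x))) \<longlonglongrightarrow> ennreal (cmod (u x - Y N x))"
          by (intro tendsto_ennrealI tendsto_intros shift elim)
        then have "liminf (\<lambda>i. ennreal (cmod (Y (s (i + N)) x - Y N x))) = ennreal (cmod (u x - Y N x))"
          by (rule lim_imp_Liminf[OF trivial_limit_sequentially])
        then show ?case by simp
      qed
    qed
    also have "\<dots> \<le> liminf (\<lambda>i. \<integral>\<^sup>+ x. ennreal (cmod (Y (s (i + N)) x - Y N x)) \<partial>\<mu>)"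
      using Yi by (intro nn_integral_liminf measurable_compose[OF _ measurable_ennreal] borel_measurable_norm borel_measurable_diff) auto
    also have "\<dots> \<le> liminf (\<lambda>i::nat. 1)"
    proof (intro Liminf_mono always_eventually allI)
      fix i
      have "(\<integral>\<^sup>+ x. ennreal (cmod (Y (s (i + N)) x - Y N x)) \<partial>\<mu>) = ennreal (\<integral>x. cmod (Y (s (i + N)) x - Y N x) \<partial>\<mu>)"
        using Yi by (intro nn_integral_eq_integral integrable_norm Bochner_Integration.integrable_diff) auto
      also have "\<dots> \<le> 1"
        using N[OF s_ge[of N i] order_refl] by (simp add: ennreal_le_1)
      finally show "(\<integral>\<^sup>+ x. ennreal (cmod (Y (s (i + N)) x - Y N x)) \<partial>\<mu>) \<le> 1" .
    qed
    also have "\<dots> < \<infinity>" by (simp add: Liminf_const)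
    finally show "(\<integral>\<^sup>+ x. ennreal (cmod (u x - Y N x)) \<partial>\<mu>) < \<infinity>" .
  qed (use um Yi in auto)
  from Bochner_Integration.integrable_add[OF this Yi[of N]] have ui: "integrable \<mu> u" by simp
  then have u: "L1loc \<Omega> u" by (rule integrable_imp_L1loc)
  have limL: "AE x in lebesgue. x \<in> \<Omega> \<longrightarrow> (\<lambda>i. Y (s i) x) \<longlonglongrightarrow> u x"
    using lim dom_sets by (simp add: AE_restrict_space_iff)
  have close: "\<exists>N. \<forall>n\<ge>N. lnorm (\<lambda>x. X n x - u x) \<le> ennreal e" if e: "e > 0" for e
  proof -
    obtain N where N: "\<And>m n. m \<ge> N \<Longrightarrow> n \<ge> N \<Longrightarrow> lnorm (\<lambda>x. X m x - X n x) < ennreal e"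
      using cauchy[OF e] by blast
    \<comment> \<open>\<open>X n\<close> is kept fixed while the other term runs along the
      subsequence. Replacing that term by its mean-free part gives a.e. convergence and leaves the
      seminorm of the difference unchanged.\<close>
    have "lnorm (\<lambda>x. X n x - u x) \<le> ennreal e" if n: "n \<ge> N" for n
    proof (rule lux_le_of_AE_tendsto[of "\<lambda>i x. X n x - Y (s (i + N)) x"])
      show "L1loc \<Omega> (\<lambda>x. X n x - Y (s (i + N)) x)" for i
        using X by (intro L1loc_diff integrable_imp_L1loc[OF Yi]) (simp add: Lambda_rep_def)
      show "AE x in lebesgue. x \<in> \<Omega> \<longrightarrow> (\<lambda>i. X n x - Y (s (i + N)) x) \<longlonglongrightarrow> X n x - u x"
        using limL
      proof eventually_elim
        case (elim x)
        then show ?case by (intro impI tendsto_intros LIMSEQ_ignore_initial_segment) auto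
      qed
      show "lnorm (\<lambda>x. X n x - Y (s (i + N)) x) < ennreal e" for i
      proof -
        have "coset_eq \<Omega> (\<lambda>x. X n x - Y (s (i + N)) x) (\<lambda>x. X n x - X (s (i + N)) x)"
          by (auto simp: coset_eq_def Y_def perp_part_def)
        then show ?thesis
          using N[OF n s_ge[of N i]] by (simp add: lux_coset_eq)
      qed
    qed
    then show ?thesis by blast
  qed
  have "Lambda_rep \<phi> a \<Omega> u"
  proof -
    obtain n where n: "lnorm (\<lambda>x. X n x - u x) \<le> ennreal 1"
      using close[of 1] by auto
    have Xn: "L1loc \<Omega> (X n)" "lnorm (X n) < top"
      using X by (auto simp: Lambda_rep_def)
    \<comment> \<open>The limit has finite seminorm because it is within distance \<open>1\<close>
      of some \<open>X n\<close>.\<close>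
    have "lnorm (\<lambda>x. X n x + (u x - X n x)) \<le> lnorm (X n) + lnorm (\<lambda>x. u x - X n x)"
      by (intro lux_triangle Xn L1loc_diff u)
    also have "\<dots> \<le> lnorm (X n) + ennreal 1"
      using n by (subst lux_minus_commute) (rule add_left_mono)
    also have "\<dots> < top"
      using Xn by simp
    finally show ?thesis using u by (simp add: Lambda_rep_def)
  qed
  moreover have "(\<lambda>n. lnorm (\<lambda>x. X n x - u x)) \<longlonglongrightarrow> 0"
  proof (rule order_tendstoI)
    fix b :: ennreal assume "0 < b"
    then obtain e where e: "e > 0" "ennreal e < b"
    proof (cases b)
      case (real B)
      then show ?thesis using \<open>0 < b\<close> that[of "B / 2"] by (auto simp: ennreal_less_iff)
    qed (use that[of 1] in auto)
    obtain N where "\<And>n. n \<ge> N \<Longrightarrow> lnorm (\<lambda>x. X n x - u x) \<le> ennreal e"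
      using close[OF e(1)] by blast
    then show "\<forall>\<^sub>F n in sequentially. lnorm (\<lambda>x. X n x - u x) < b"
      using e(2) unfolding eventually_sequentially by (meson le_less_trans)
  qed simp
  ultimately show ?thesis by (rule that)
qed

section \<open>Splitting off the mean and the equivalence of norms\<close>

text \<open>\<open>Lp_norm\<close> takes the value \<open>top\<close> outside \<open>L_p\<close>, so
  finiteness of \<open>fnorm\<close> already yields membership.\<close>

lemma Lcal_D:
  assumes "Lcal \<phi> a \<Omega> p u"
  shows "Lp_on \<Omega> p u" and "Lambda_rep \<phi> a \<Omega> u"
proof -
  have fin: "lnorm u < top" "Lnorm u < top"
    using assms by (auto simp: Lcal_def fnorm_def)
  then show Lp: "Lp_on \<Omega> p u"
    by (auto simp: Lp_norm_def split: if_splits)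
  then show "Lambda_rep \<phi> a \<Omega> u"
    using fin by (simp add: Lambda_rep_def integrable_imp_L1loc Lp_on_imp_integrable)
qed

lemma Lcal_add_const:
  assumes "Lambda_rep \<phi> a \<Omega> v"
  shows "Lcal \<phi> a \<Omega> p (\<lambda>x. v x + c)"
proof -
  have Lp: "Lp_on \<Omega> p (\<lambda>x. v x + c)"
    by (intro Lp_on_add_const Lambda_rep_Lp_on assms)
  have "lnorm (\<lambda>x. v x + c) = lnorm v"
    by (intro lux_coset_eq coset_eq_add_const)
  then show ?thesis
    using Lp assms by (simp add: Lcal_def fnorm_def Lp_on_imp_Lploc Lp_norm_eq Lambda_rep_def)
qed

lemma ex_zero_mean_representative:
  assumes u: "Lambda_rep \<phi> a \<Omega> u"
  shows "\<exists>v. coset_eq \<Omega> v u \<and> L1loc \<Omega> v \<and> Lp_on \<Omega> p v \<and> mean_val \<Omega> v = 0 \<and>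
    (\<forall>w. coset_eq \<Omega> w u \<and> L1loc \<Omega> w \<and> Lp_on \<Omega> p w \<and> mean_val \<Omega> w = 0
       \<longrightarrow> (AE x in lebesgue. x \<in> \<Omega> \<longrightarrow> w x = v x))"
proof -
  have Lp: "Lp_on \<Omega> p (perp_part \<Omega> u)"
    unfolding perp_part_eq by (intro Lp_on_add_const Lambda_rep_Lp_on u)
  show ?thesis
    using Lp coset_eq_perp mean_val_perp[OF Lambda_rep_integrable[OF u]]
      coset_eq_mean_unique[OF Lp_on_imp_integrable[OF Lp] Lp_on_imp_integrable]
    by (intro exI[of _ "perp_part \<Omega> u"]) (auto intro: integrable_imp_L1loc Lp_on_imp_integrable)
qed

text \<open>The seminorm ignores the mean. The lower bound controls the mean by the
  \<open>L_p\<close> norm with factor \<open>D\<close>; the upper bound splits the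
  \<open>L_p\<close> norm with factor \<open>A\<close> and controls the mean-free part by the
  Poincare factor \<open>B\<close>.\<close>

lemma fnorm_equivalence:
  "\<exists>c3 c4. c3 > 0 \<and> c4 > 0 \<and> (\<forall>u. Lcal \<phi> a \<Omega> p u \<longrightarrow>
     ennreal c3 * (lnorm (perp_part \<Omega> u) + ennreal (cmod (mean_val \<Omega> u))) \<le> fnorm \<phi> a \<Omega> p u \<and>
     fnorm \<phi> a \<Omega> p u \<le> ennreal c4 * (lnorm (perp_part \<Omega> u) + ennreal (cmod (mean_val \<Omega> u))))"
proof -
  define D where "D = (vol + 1) / vol"
  define A where "A = 2 * (1 + vol) powr (1 / p)"
  define B where "B = poincare_const powr (1 / p)"
  have pos: "D > 0" "A > 0" "B \<ge> 0"
    using vol_pos by (auto simp: D_def A_def B_def)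
  have "ennreal (1 / (1 + D)) * (lnorm (perp_part \<Omega> u) + ennreal (cmod (mean_val \<Omega> u))) \<le> fnorm \<phi> a \<Omega> p u"
      "fnorm \<phi> a \<Omega> p u \<le> ennreal (1 + A * B + A) * (lnorm (perp_part \<Omega> u) + ennreal (cmod (mean_val \<Omega> u)))"
    if "Lcal \<phi> a \<Omega> p u" for u
  proof -
    note Lp = Lcal_D(1)[OF that] and u = Lcal_D(2)[OF that]
    have L: "lnorm (perp_part \<Omega> u) = lnorm u"
      by (intro lux_coset_eq coset_eq_perp)
    let ?m = "ennreal (cmod (mean_val \<Omega> u))"
    have "lnorm u + ?m \<le> ennreal (1 + D) * lnorm u + ennreal (1 + D) * Lnorm u"
    proof (rule add_mono)
      have "1 * lnorm u \<le> ennreal (1 + D) * lnorm u"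
        using pos by (intro mult_right_mono) (simp_all add: add_increasing2 del: ennreal_plus flip: ennreal_1)
      then show "lnorm u \<le> ennreal (1 + D) * lnorm u" by simp
      have "?m \<le> ennreal D * Lnorm u"
        unfolding D_def by (rule mean_le_Lp_norm[OF Lp])
      also have "\<dots> \<le> ennreal (1 + D) * Lnorm u"
        by (intro mult_right_mono ennreal_leI) auto
      finally show "?m \<le> ennreal (1 + D) * Lnorm u" .
    qed
    also have "\<dots> = ennreal (1 + D) * fnorm \<phi> a \<Omega> p u"
      by (simp add: fnorm_def distrib_left)
    finally have "ennreal (1 / (1 + D)) * (lnorm u + ?m) \<le> ennreal (1 / (1 + D)) * (ennreal (1 + D) * fnorm \<phi> a \<Omega> p u)"
      by (intro mult_left_mono) auto
    also have "\<dots> = fnorm \<phi> a \<Omega> p u"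
      using pos by (simp add: mult.assoc[symmetric] ennreal_mult[symmetric] del: ennreal_plus)
    finally show "ennreal (1 / (1 + D)) * (lnorm (perp_part \<Omega> u) + ?m) \<le> fnorm \<phi> a \<Omega> p u"
      by (simp add: L)
    have Lp': "Lp_on \<Omega> p (perp_part \<Omega> u)"
      unfolding perp_part_eq by (rule Lp_on_add_const[OF Lp])
    have "Lnorm u \<le> ennreal A * (Lnorm (perp_part \<Omega> u) + ?m)"
      using Lp_norm_add_const_le[OF Lp', of "mean_val \<Omega> u"] by (simp add: A_def perp_part_def)
    also have "\<dots> \<le> ennreal A * (ennreal B * lnorm u + ?m)"
      unfolding B_def by (intro mult_left_mono add_right_mono Lp_norm_perp_le u) auto
    finally have "fnorm \<phi> a \<Omega> p u \<le> lnorm u + ennreal A * (ennreal B * lnorm u + ?m)"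
      unfolding fnorm_def by (rule add_left_mono)
    \<comment> \<open>The added terms are those missing from the expansion of
      \<open>(1 + A * B + A) * (lnorm u + ?m)\<close>.\<close>
    also have "\<dots> \<le> (lnorm u + ennreal A * (ennreal B * lnorm u + ?m)) + (?m + ennreal A * (ennreal B * ?m) + ennreal A * lnorm u)"
      by simp
    also have "\<dots> = ennreal (1 + A * B + A) * (lnorm u + ?m)"
      using pos by (simp add: ennreal_mult distrib_left distrib_right ac_simps)
    finally show "fnorm \<phi> a \<Omega> p u \<le> ennreal (1 + A * B + A) * (lnorm (perp_part \<Omega> u) + ?m)"
      by (simp add: L)
  qed
  then show ?thesis
    using pos by (intro exI[of _ "1 / (1 + D)"] exI[of _ "1 + A * B + A"]) (auto intro!: add_pos_pos add_pos_nonneg)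
qed

end

section \<open>The hypotheses on the integrand\<close>

text \<open>The exceptional null set in (C2) depends on \<open>\<epsilon>\<close>; restricting to
  \<open>1 / Suc n\<close> leaves a countable union. Any \<open>s \<noteq> t\<close> satisfies the
  separation condition for large \<open>n\<close>, and \<open>s = t\<close> is trivial.\<close>

lemma C2_imp_midpoint_convex:
  assumes c2: "C2 \<phi> \<Omega>" and nonneg: "\<forall>t\<ge>0. \<forall>x\<in>\<Omega>. \<forall>y\<in>\<Omega>. \<phi> t x y \<ge> 0"
  shows "AE z in lebesgue. z \<in> \<Omega> \<times> \<Omega> \<longrightarrow> (\<forall>s t. s > 0 \<longrightarrow> t > 0 \<longrightarrow>
     \<phi> ((s + t) / 2) (fst z) (snd z) \<le> (\<phi> s (fst z) (snd z) + \<phi> t (fst z) (snd z)) / 2)"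
proof -
  have mid: "AE z in lebesgue. z \<in> \<Omega> \<times> \<Omega> \<longrightarrow> (\<forall>s t. s > 0 \<and> t > 0 \<and> \<bar>s - t\<bar> \<ge> \<epsilon> * max s t \<longrightarrow>
     \<phi> ((s + t) / 2) (fst z) (snd z) \<le> (\<phi> s (fst z) (snd z) + \<phi> t (fst z) (snd z)) / 2)"
    if eps: "\<epsilon> > 0" for \<epsilon>
  proof -
    obtain \<delta> where \<delta>: "0 < \<delta>" "\<delta> < 1"
      and ae: "AE z in lebesgue. z \<in> \<Omega> \<times> \<Omega> \<longrightarrow>
        (\<forall>s t. s > 0 \<and> t > 0 \<and> \<bar>s - t\<bar> \<ge> \<epsilon> * max s t \<longrightarrow>
           \<phi> ((s + t) / 2) (fst z) (snd z)
             \<le> (1 - \<delta>) * ((\<phi> s (fst z) (snd z) + \<phi> t (fst z) (snd z)) / 2))"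
      using c2 eps unfolding C2_def by blast
    \<comment> \<open>Only convexity is extracted, so the gain \<open>1 - \<delta>\<close> is
      discarded, using nonnegativity of the integrand.\<close>
    have drop: "(1 - \<delta>) * ((\<phi> s x y + \<phi> t x y) / 2) \<le> (\<phi> s x y + \<phi> t x y) / 2"
      if "x \<in> \<Omega>" "y \<in> \<Omega>" "s > 0" "t > 0" for s t x y
      using \<delta> nonneg that by (intro mult_left_le_one_le) auto
    show ?thesis
      using ae
    proof eventually_elim
      case (elim z)
      show ?case
      proof (intro impI allI)
        fix s t assume "z \<in> \<Omega> \<times> \<Omega>" and st: "s > 0 \<and> t > 0 \<and> \<bar>s - t\<bar> \<ge> \<epsilon> * max s t"
        then show "\<phi> ((s + t) / 2) (fst z) (snd z) \<le> (\<phi> s (fst z) (snd z) + \<phi> t (fst z) (snd z)) / 2"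
          using elim by (intro order_trans[OF _ drop]) (auto simp: mem_Times_iff)
      qed
    qed
  qed
  have "AE z in lebesgue. \<forall>n. z \<in> \<Omega> \<times> \<Omega> \<longrightarrow> (\<forall>s t. s > 0 \<and> t > 0 \<and> \<bar>s - t\<bar> \<ge> 1 / Suc n * max s t \<longrightarrow>
     \<phi> ((s + t) / 2) (fst z) (snd z) \<le> (\<phi> s (fst z) (snd z) + \<phi> t (fst z) (snd z)) / 2)"
    unfolding AE_all_countable by (intro allI mid) simp
  then show ?thesis
  proof eventually_elim
    case (elim z)
    show ?case
    proof (intro impI allI)
      fix s t :: real assume z: "z \<in> \<Omega> \<times> \<Omega>" and st: "s > 0" "t > 0"
      show "\<phi> ((s + t) / 2) (fst z) (snd z) \<le> (\<phi> s (fst z) (snd z) + \<phi> t (fst z) (snd z)) / 2"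
      proof (cases "s = t")
        case False
        then have "\<bar>s - t\<bar> / max s t > 0"
          using st by (intro divide_pos_pos) auto
        then obtain n where "inverse (real (Suc n)) < \<bar>s - t\<bar> / max s t"
          using reals_Archimedean by blast
        then have "\<bar>s - t\<bar> \<ge> 1 / Suc n * max s t"
          using st by (auto simp: field_simps max_def split: if_splits)
        then show ?thesis using elim z st by blast
      qed simp
    qed
  qed
qed

lemma nonlocal_energyI:
  fixes \<Omega> :: "'a::euclidean_space set"
  assumes dom: "open \<Omega>" "connected \<Omega>" "\<Omega> \<noteq> {}" "bounded \<Omega>"
    and ker: "kernel_cond a"
    and nonneg: "\<forall>t\<ge>0. \<forall>x\<in>\<Omega>. \<forall>y\<in>\<Omega>. \<phi> t x y \<ge> 0"
    and c1: "C1 \<phi> \<Omega>" and c2: "C2 \<phi> \<Omega>" and c3: "C3 \<phi> \<Omega> pm pp" and c4: "C4 \<phi> \<Omega>"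
  obtains r c0 k where "nonlocal_energy \<Omega> a \<phi> pm r c0 k"
proof -
  obtain r c0 where r: "r > 0" "c0 > 0" "AE z in lebesgue. z \<in> ball 0 r \<longrightarrow> a z \<ge> c0"
    using ker unfolding kernel_cond_def by blast
  obtain \<beta> where pm: "1 < pm" and \<beta>: "\<beta> \<ge> 1"
    and incr: "AE z in lebesgue. z \<in> \<Omega> \<times> \<Omega> \<longrightarrow>
       almost_increasing_on {0<..} \<beta> (\<lambda>t. \<phi> t (fst z) (snd z) / t powr pm) \<and>
       almost_decreasing_on {0<..} \<beta> (\<lambda>t. \<phi> t (fst z) (snd z) / t powr pp)"
    using c3 unfolding C3_def by blast
  obtain c where c: "c > 0" and one: "AE z in lebesgue. z \<in> \<Omega> \<times> \<Omega> \<longrightarrow>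
       inverse c \<le> \<phi> 1 (fst z) (snd z) \<and> \<phi> 1 (fst z) (snd z) \<le> c \<and>
       \<phi> 0 (fst z) (snd z) = 0 \<and> (\<forall>t>0. \<phi> t (fst z) (snd z) > 0)"
    using c4 unfolding C4_def by blast
  have nn: "\<phi> t x y \<ge> 0" if "t \<ge> 0" "x \<in> \<Omega>" "y \<in> \<Omega>" for t x y
    using nonneg that by blast
  \<comment> \<open>The coercivity constant combines the almost-monotonicity constant
    \<open>\<beta>\<close> with the bound \<open>c\<close> for the integrand at
    \<open>1\<close>.\<close>
  have "nonlocal_energy \<Omega> a \<phi> pm r c0 (\<beta> * c)"
  proof
    show "AE z in lebesgue. z \<in> \<Omega> \<times> \<Omega> \<longrightarrow>
       \<phi> 0 (fst z) (snd z) = 0 \<and> convex_on {0..} (\<lambda>t. \<phi> t (fst z) (snd z)) \<and>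
       continuous_on {0..} (\<lambda>t. \<phi> t (fst z) (snd z))"
      using incr one C2_imp_midpoint_convex[OF c2 nonneg]
    proof eventually_elim
      case (elim z)
      show ?case
      proof
        assume "z \<in> \<Omega> \<times> \<Omega>"
        then show "\<phi> 0 (fst z) (snd z) = 0 \<and> convex_on {0..} (\<lambda>t. \<phi> t (fst z) (snd z)) \<and>
            continuous_on {0..} (\<lambda>t. \<phi> t (fst z) (snd z))"
          using elim almost_increasing_imp_convex[of "\<lambda>t. \<phi> t (fst z) (snd z)" pm \<beta>] nn pm
          by (auto simp: mem_Times_iff)
      qed
    qed
    show "AE z in lebesgue. z \<in> \<Omega> \<times> \<Omega> \<longrightarrow> (\<forall>t\<ge>0. t powr pm \<le> 1 + \<beta> * c * \<phi> t (fst z) (snd z))"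
      using incr one
    proof eventually_elim
      case (elim z)
      then show ?case
        using almost_increasing_imp_coercive[of "\<lambda>t. \<phi> t (fst z) (snd z)" pm c \<beta>] nn pm c
        by (auto simp: mem_Times_iff)
    qed
  qed (use dom ker r pm \<beta> c c1 nn in \<open>auto simp: kernel_cond_def\<close>)
  then show ?thesis by (rule that)
qed

text \<open>The coset space is handled through representatives: invariance under
  \<open>coset_eq\<close> makes the functional well defined on cosets, and definiteness is stated
  modulo constants.\<close>

theorem theorem2p5:
  fixes \<Omega> :: "'a::euclidean_space set"
    and a :: "'a \<Rightarrow> real"
    and \<phi> :: "real \<Rightarrow> 'a \<Rightarrow> 'a \<Rightarrow> real"
    and pm pp :: real
  assumes dom: "open \<Omega>" "connected \<Omega>" "\<Omega> \<noteq> {}"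
    and bdd: "bounded \<Omega>"
    and lip: "lipschitz_boundary \<Omega>"
    and ker: "kernel_cond a"
    and nonneg: "\<forall>t\<ge>0. \<forall>x\<in>\<Omega>. \<forall>y\<in>\<Omega>. \<phi> t x y \<ge> 0"
    and c1: "C1 \<phi> \<Omega>" and c2: "C2 \<phi> \<Omega>" and c3: "C3 \<phi> \<Omega> pm pp" and c4: "C4 \<phi> \<Omega>"
  shows
    \<comment> \<open>(1) |.|_{p,Omega} is a norm on Lambda(Omega) = cosets modulo constants\<close>
    "(\<forall>u v. L1loc \<Omega> u \<and> L1loc \<Omega> v \<and> coset_eq \<Omega> u v \<longrightarrow> lux \<phi> a \<Omega> u = lux \<phi> a \<Omega> v)
   \<and> (\<forall>u v. Lambda_rep \<phi> a \<Omega> u \<and> Lambda_rep \<phi> a \<Omega> v \<longrightarrow>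
        lux \<phi> a \<Omega> (\<lambda>x. u x + v x) \<le> lux \<phi> a \<Omega> u + lux \<phi> a \<Omega> v)
   \<and> (\<forall>u c. Lambda_rep \<phi> a \<Omega> u \<longrightarrow>
        lux \<phi> a \<Omega> (\<lambda>x. c * u x) = ennreal (cmod c) * lux \<phi> a \<Omega> u)
   \<and> (\<forall>u. Lambda_rep \<phi> a \<Omega> u \<and> lux \<phi> a \<Omega> u = 0 \<longrightarrow> coset_eq \<Omega> u (\<lambda>x. 0))
    \<comment> \<open>(2) completeness\<close>
   \<and> (\<forall>X :: nat \<Rightarrow> 'a \<Rightarrow> complex.
        (\<forall>n. Lambda_rep \<phi> a \<Omega> (X n)) \<and>
        (\<forall>e>0. \<exists>N. \<forall>m\<ge>N. \<forall>n\<ge>N. lux \<phi> a \<Omega> (\<lambda>x. X m x - X n x) < ennreal e)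
        \<longrightarrow> (\<exists>u. Lambda_rep \<phi> a \<Omega> u \<and>
               ((\<lambda>n. lux \<phi> a \<Omega> (\<lambda>x. X n x - u x)) \<longlongrightarrow> 0) sequentially))
    \<comment> \<open>(3) unique L_{p-} representative with zero mean in each coset\<close>
   \<and> (\<forall>u. Lambda_rep \<phi> a \<Omega> u \<longrightarrow>
        (\<exists>v. coset_eq \<Omega> v u \<and> L1loc \<Omega> v \<and> Lp_on \<Omega> pm v \<and> mean_val \<Omega> v = 0 \<and>
             (\<forall>w. coset_eq \<Omega> w u \<and> L1loc \<Omega> w \<and> Lp_on \<Omega> pm w \<and> mean_val \<Omega> w = 0
                  \<longrightarrow> (AE x in lebesgue. x \<in> \<Omega> \<longrightarrow> w x = v x))))
    \<comment> \<open>(4) script-L(Omega) = Lambda(Omega) (+) C\<close>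
   \<and> (\<forall>u. Lcal \<phi> a \<Omega> pm u \<longrightarrow>
        Lambda_rep \<phi> a \<Omega> u \<and> coset_eq \<Omega> (perp_part \<Omega> u) u \<and>
        Lp_on \<Omega> pm (perp_part \<Omega> u) \<and> mean_val \<Omega> (perp_part \<Omega> u) = 0 \<and>
        (\<forall>x. u x = perp_part \<Omega> u x + mean_val \<Omega> u))
   \<and> (\<forall>v c. Lambda_rep \<phi> a \<Omega> v \<and> Lp_on \<Omega> pm v \<and> mean_val \<Omega> v = 0 \<longrightarrow>
        Lcal \<phi> a \<Omega> pm (\<lambda>x. v x + c) \<and> mean_val \<Omega> (\<lambda>x. v x + c) = c)
    \<comment> \<open>(5) norm equivalence\<close>
   \<and> (\<exists>c3 c4. c3 > 0 \<and> c4 > 0 \<and> (\<forall>u. Lcal \<phi> a \<Omega> pm u \<longrightarrow>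
        ennreal c3 * (lux \<phi> a \<Omega> (perp_part \<Omega> u) + ennreal (cmod (mean_val \<Omega> u)))
          \<le> fnorm \<phi> a \<Omega> pm u \<and>
        fnorm \<phi> a \<Omega> pm u
          \<le> ennreal c4 * (lux \<phi> a \<Omega> (perp_part \<Omega> u) + ennreal (cmod (mean_val \<Omega> u)))))"
proof -
  obtain r c0 k where "nonlocal_energy \<Omega> a \<phi> pm r c0 k"
    using nonlocal_energyI[OF dom bdd ker nonneg c1 c2 c3 c4] .
  then interpret nonlocal_energy \<Omega> a \<phi> pm r c0 k .
  show ?thesis
  proof (intro conjI allI impI)
    show "lnorm u = lnorm v" if "L1loc \<Omega> u \<and> L1loc \<Omega> v \<and> coset_eq \<Omega> u v" for u v
      using that lux_coset_eq by blast
    show "lnorm (\<lambda>x. u x + v x) \<le> lnorm u + lnorm v"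
      if "Lambda_rep \<phi> a \<Omega> u \<and> Lambda_rep \<phi> a \<Omega> v" for u v
      using that by (intro lux_triangle) (auto simp: Lambda_rep_def)
    show "lnorm (\<lambda>x. c * u x) = ennreal (cmod c) * lnorm u" if "Lambda_rep \<phi> a \<Omega> u" for u c
      using that by (intro lux_cmult) (auto simp: Lambda_rep_def)
    show "coset_eq \<Omega> u (\<lambda>x. 0)" if "Lambda_rep \<phi> a \<Omega> u \<and> lnorm u = 0" for u
      using that lux_eq_0_imp_const by blast
    show "\<exists>u. Lambda_rep \<phi> a \<Omega> u \<and> (\<lambda>n. lnorm (\<lambda>x. X n x - u x)) \<longlonglongrightarrow> 0"
      if X: "(\<forall>n. Lambda_rep \<phi> a \<Omega> (X n)) \<and>
        (\<forall>e>0. \<exists>N. \<forall>m\<ge>N. \<forall>n\<ge>N. lnorm (\<lambda>x. X m x - X n x) < ennreal e)" for X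
    proof (rule lux_complete)
      show "Lambda_rep \<phi> a \<Omega> (X n)" for n
        using X by (rule conjunct1[THEN spec])
      show "\<exists>N. \<forall>m\<ge>N. \<forall>n\<ge>N. lnorm (\<lambda>x. X m x - X n x) < ennreal e" if "e > 0" for e
        using conjunct2[OF X] that by (elim allE impE)
    qed (intro exI conjI)
    show "\<exists>v. coset_eq \<Omega> v u \<and> L1loc \<Omega> v \<and> Lp_on \<Omega> pm v \<and> mean_val \<Omega> v = 0 \<and>
        (\<forall>w. coset_eq \<Omega> w u \<and> L1loc \<Omega> w \<and> Lp_on \<Omega> pm w \<and> mean_val \<Omega> w = 0
           \<longrightarrow> (AE x in lebesgue. x \<in> \<Omega> \<longrightarrow> w x = v x))" if "Lambda_rep \<phi> a \<Omega> u" for u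
      using that by (rule ex_zero_mean_representative)
    show "Lambda_rep \<phi> a \<Omega> u" if "Lcal \<phi> a \<Omega> pm u" for u
      using Lcal_D(2)[OF that] .
    show "coset_eq \<Omega> (perp_part \<Omega> u) u" for u
      by (rule coset_eq_perp)
    show "Lp_on \<Omega> pm (perp_part \<Omega> u)" if "Lcal \<phi> a \<Omega> pm u" for u
      unfolding perp_part_eq by (rule Lp_on_add_const[OF Lcal_D(1)[OF that]])
    show "mean_val \<Omega> (perp_part \<Omega> u) = 0" if "Lcal \<phi> a \<Omega> pm u" for u
      by (rule mean_val_perp[OF Lambda_rep_integrable[OF Lcal_D(2)[OF that]]])
    show "u x = perp_part \<Omega> u x + mean_val \<Omega> u" for u x
      by (simp add: perp_part_def)
    show "Lcal \<phi> a \<Omega> pm (\<lambda>x. v x + c)"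
      if "Lambda_rep \<phi> a \<Omega> v \<and> Lp_on \<Omega> pm v \<and> mean_val \<Omega> v = 0" for v c
      using that by (intro Lcal_add_const) auto
    show "mean_val \<Omega> (\<lambda>x. v x + c) = c"
      if "Lambda_rep \<phi> a \<Omega> v \<and> Lp_on \<Omega> pm v \<and> mean_val \<Omega> v = 0" for v c
      using that mean_val_add_const[OF Lp_on_imp_integrable] by auto
  qed (rule fnorm_equivalence)
qed

end
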